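(* Let $(x_n)_{n=1}^\infty$ be a Bessel or an outer Bessel sequence in a Hilbert $C^*$-module $X$ over a $C^*$-algebra $\mathsf{A}$, with analysis operator $U$. Then there is a finite extension of $(x_n)_n$ to a frame or an outer frame for $X$ if and only if there exist $V\in\mathbb{B}(X,\ell^2(\mathsf{A}))$ and $\theta\in\mathbb{F}(M(X))$ such that $I-V^*U=\theta|_X$.
   Context: $\mathsf{A}$ is an arbitrary $C^*$-algebra (not necessarily unital) with multiplier algebra $M(\mathsf{A})$. Hilbert $\mathsf{A}$-modules are right modules with inner product $\mathsf{A}$-linear in the second variable; they are not assumed full. $\mathbb{B}(X,Y)$ denotes the adjointable operators from $X$ to $Y$; $I$ is the identity operator on $X$. For a Hilbert module $Z$, $\mathbb{F}(Z)$ is the linear span of the operators $\theta_{w,z}$, $w,z\in Z$, where $\theta_{w,z}(u)=w\langle z,u\rangle$. $\ell^2(\mathsf{A})$ is the Hilbert $\mathsf{A}$-module of sequences $(a_n)_n$ in $\mathsf{A}$ with $\sum_n a_n^*a_n$ norm convergent, with inner product $\langle (a_n)_n,(b_n)_n\rangle=\sum_n a_n^*b_n$. $M(X)$ denotes the multiplier module of $X$: $M(X)=\mathbb{B}(\mathsf{A},X)$, a Hilbert $M(\mathsf{A})$-module with $\langle v,w\rangle=v^*w\in\mathbb{B}(\mathsf{A})=M(\mathsf{A})$, containing $X$ via $x\mapsto(a\mapsto xa)$, and $M(X)\mathsf{A}=X$; thus $\langle v,x\rangle\in\mathsf{A}$ for $v\in M(X)$, $x\in X$. $\mathbb{F}(M(X))$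 is formed in the Hilbert $M(\mathsf{A})$-module $M(X)$; its elements map $X$ into $X$. A sequence $(x_n)_n$ in $X$ is a frame for $X$ if there are constants $A,B>0$ with $A\langle x,x\rangle\le\sum_{n=1}^\infty\langle x,x_n\rangle\langle x_n,x\rangle\le B\langle x,x\rangle$ for all $x\in X$, the series converging in norm; it is a Bessel sequence if only the second inequality is required. A sequence $(x_n)_n$ in $M(X)$ with $x_n\in M(X)\setminus X$ for at least one $n$ is an outer frame (resp. outer Bessel sequence) for $X$ if the same inequalities (resp. the second one) hold for all $x\in X$ with norm convergence in $\mathsf{A}$. The analysis operator of a (outer) Bessel sequence is $U\in\mathbb{B}(X,\ell^2(\mathsf{A}))$, $Ux=(\langle x_n,x\rangle)_n$. A finite extension of $(x_n)_{n=1}^\infty$ to a frame or outer frame for $X$ is a finite sequence $f_1,\dots,f_N\in M(X)$, $N\in\mathbb{N}$, such that $(f_n)_{n=1}^N\cup(x_n)_{n=1}^\infty$, i.e. $f_1,\dots,f_N,x_1,x_2,\dots$, is a frame or an outer frame for $X$. *)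

theory Defs
  imports "HOL-Analysis.Analysis" "HOL-Library.Function_Algebras" "HOL-Library.FuncSet"
begin

section \<open>Complex vector spaces\<close>

class complex_vector = ab_group_add +
  fixes scaleC :: "complex \<Rightarrow> 'a \<Rightarrow> 'a"  (infixr \<open>*c\<close> 75)
  assumes scaleC_add_right: "c *c (x + y) = c *c x + c *c y"
    and scaleC_add_left: "(c + d) *c x = c *c x + d *c x"
    and scaleC_scaleC: "c *c (d *c x) = (c * d) *c x"
    and scaleC_one: "1 *c x = x"

global_interpretation complex_vector: vector_space "scaleC :: complex \<Rightarrow> 'a \<Rightarrow> 'a::complex_vector"
  by unfold_locales (simp_all add: scaleC_add_right scaleC_add_left scaleC_scaleC scaleC_one)

instantiation "fun" :: (type, complex_vector) complex_vector
begin

definition scaleC_fun :: "complex \<Rightarrow> ('a \<Rightarrow> 'b) \<Rightarrow> 'a \<Rightarrow> 'b" where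
  "scaleC_fun c f = (\<lambda>x. c *c f x)"

instance
  by standard
    (simp_all add: scaleC_fun_def fun_eq_iff scaleC_add_right scaleC_add_left scaleC_scaleC scaleC_one)

end


section \<open>\<open>C\<^sup>*\<close>-algebras\<close>

text \<open>The algebras are not assumed unital; the trivial algebra is included.\<close>

class cstar_algebra = complex_vector + real_normed_algebra + banach +
  fixes cstar :: "'a \<Rightarrow> 'a"  (\<open>_\<^sup>\<star>\<close> [1000] 999)
  assumes scaleC_of_real: "complex_of_real r *c x = r *\<^sub>R x"
    and scaleC_mult_left: "(c *c x) * y = c *c (x * y)"
    and scaleC_mult_right: "x * (c *c y) = c *c (x * y)"
    and norm_scaleC: "norm (c *c x) = cmod c * norm x"
    and cstar_add: "(x + y)\<^sup>\<star> = x\<^sup>\<star> + y\<^sup>\<star>"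
    and cstar_scaleC: "(c *c x)\<^sup>\<star> = cnj c *c x\<^sup>\<star>"
    and cstar_mult: "(x * y)\<^sup>\<star> = y\<^sup>\<star> * x\<^sup>\<star>"
    and cstar_cstar: "(x\<^sup>\<star>)\<^sup>\<star> = x"
    and norm_cstar_mult: "norm (x\<^sup>\<star> * x) = (norm x)\<^sup>2"

text \<open>The positive cone is \<open>{b\<^sup>\<star> b}\<close>. The order is not the class order \<open>\<le>\<close>,
  which is not available on \<open>'a\<close>.\<close>

definition cstar_le :: "'a::cstar_algebra \<Rightarrow> 'a \<Rightarrow> bool"  (infix \<open>\<preceq>\<close> 50) where
  "a \<preceq> b \<longleftrightarrow> (\<exists>c. b - a = c\<^sup>\<star> * c)"


section \<open>Hilbert modules\<close>

text \<open>In \<open>('x, 'b) hmod\<close> the elements live in the complex vector space \<open>'x\<close> and the inner product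
  takes values in \<open>'b\<close>, which also acts from the right. The type \<open>'b\<close> is left unconstrained because
  the multiplier algebra of \<open>'a\<close> is used below as a set of functions \<open>'a \<Rightarrow> 'a\<close>.\<close>

record ('x, 'b) hmod =
  hcarrier :: "'x set"
  hact :: "'x \<Rightarrow> 'b \<Rightarrow> 'x"
  hip :: "'x \<Rightarrow> 'x \<Rightarrow> 'b"

definition hnorm :: "('x, 'a::cstar_algebra) hmod \<Rightarrow> 'x \<Rightarrow> real" where
  "hnorm X x = sqrt (norm (hip X x x))"

locale hilbert_module =
  fixes X :: "('x::complex_vector, 'a::cstar_algebra) hmod"
  assumes subspace_carrier: "complex_vector.subspace (hcarrier X)"
    and act_closed: "x \<in> hcarrier X \<Longrightarrow> hact X x a \<in> hcarrier X"
    and act_add_left: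
      "x \<in> hcarrier X \<Longrightarrow> y \<in> hcarrier X \<Longrightarrow> hact X (x + y) a = hact X x a + hact X y a"
    and act_add_right: "x \<in> hcarrier X \<Longrightarrow> hact X x (a + b) = hact X x a + hact X x b"
    and act_mult: "x \<in> hcarrier X \<Longrightarrow> hact X x (a * b) = hact X (hact X x a) b"
    and act_scaleC_left: "x \<in> hcarrier X \<Longrightarrow> hact X (c *c x) a = c *c hact X x a"
    and act_scaleC_right: "x \<in> hcarrier X \<Longrightarrow> hact X x (c *c a) = c *c hact X x a"
    and ip_add_right:
      "x \<in> hcarrier X \<Longrightarrow> y \<in> hcarrier X \<Longrightarrow> z \<in> hcarrier X \<Longrightarrow>
        hip X x (y + z) = hip X x y + hip X x z"
    and ip_scaleC_right:
      "x \<in> hcarrier X \<Longrightarrow> y \<in> hcarrier X \<Longrightarrow> hip X x (c *c y) = c *c hip X x y"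
    and ip_act_right:
      "x \<in> hcarrier X \<Longrightarrow> y \<in> hcarrier X \<Longrightarrow> hip X x (hact X y a) = hip X x y * a"
    and ip_sym: "x \<in> hcarrier X \<Longrightarrow> y \<in> hcarrier X \<Longrightarrow> hip X y x = (hip X x y)\<^sup>\<star>"
    and ip_pos: "x \<in> hcarrier X \<Longrightarrow> 0 \<preceq> hip X x x"
    and ip_definite: "x \<in> hcarrier X \<Longrightarrow> hip X x x = 0 \<Longrightarrow> x = 0"
    and complete:
      "(\<And>n. s n \<in> hcarrier X) \<Longrightarrow>
       (\<And>e. e > 0 \<Longrightarrow> \<exists>M. \<forall>m\<ge>M. \<forall>n\<ge>M. hnorm X (s m - s n) < e) \<Longrightarrow>
       \<exists>l\<in>hcarrier X. (\<lambda>n. hnorm X (s n - l)) \<longlonglongrightarrow> 0"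

definition self_module :: "('a::cstar_algebra, 'a) hmod" where
  "self_module = \<lparr>hcarrier = UNIV, hact = (*), hip = (\<lambda>a b. a\<^sup>\<star> * b)\<rparr>"

definition ell2 :: "(nat \<Rightarrow> 'a::cstar_algebra, 'a) hmod" where
  "ell2 = \<lparr>hcarrier = {a. summable (\<lambda>n. (a n)\<^sup>\<star> * a n)},
           hact = (\<lambda>a c n. a n * c),
           hip = (\<lambda>a b. \<Sum>n. (a n)\<^sup>\<star> * b n)\<rparr>"


section \<open>Adjointable operators\<close>

text \<open>Operators are total functions of which only the values on the carrier matter.
  Linearity and boundedness of adjointable operators are automatic.\<close>

definition is_adjoint ::
    "('x, 'b) hmod \<Rightarrow> ('y, 'b) hmod \<Rightarrow> ('x \<Rightarrow> 'y) \<Rightarrow> ('y \<Rightarrow> 'x) \<Rightarrow> bool" where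
  "is_adjoint X Y T S \<longleftrightarrow>
     S \<in> hcarrier Y \<rightarrow> hcarrier X \<and>
     (\<forall>x\<in>hcarrier X. \<forall>y\<in>hcarrier Y. hip Y (T x) y = hip X x (S y))"

definition adjointable :: "('x, 'b) hmod \<Rightarrow> ('y, 'b) hmod \<Rightarrow> ('x \<Rightarrow> 'y) set" where
  "adjointable X Y = {T. T \<in> hcarrier X \<rightarrow> hcarrier Y \<and> (\<exists>S. is_adjoint X Y T S)}"

text \<open>For Hilbert modules the adjoint is determined on the carrier of \<open>Y\<close>; the choice only affects
  its values elsewhere.\<close>

definition adj :: "('x, 'b) hmod \<Rightarrow> ('y, 'b) hmod \<Rightarrow> ('x \<Rightarrow> 'y) \<Rightarrow> 'y \<Rightarrow> 'x" where
  "adj X Y T = (SOME S. is_adjoint X Y T S)"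

definition theta :: "('z, 'b) hmod \<Rightarrow> 'z \<Rightarrow> 'z \<Rightarrow> 'z \<Rightarrow> 'z" where
  "theta Z w z = (\<lambda>u. hact Z w (hip Z z u))"

definition finite_rank_ops :: "('z::complex_vector, 'b) hmod \<Rightarrow> ('z \<Rightarrow> 'z) set" where
  "finite_rank_ops Z =
     complex_vector.span {theta Z w z | w z. w \<in> hcarrier Z \<and> z \<in> hcarrier Z}"


section \<open>The multiplier module\<close>

text \<open>\<open>M(X)\<close> is the set of adjointable operators from \<open>'a\<close> to \<open>X\<close>. Its inner product takes values in
  the adjointable operators on \<open>'a\<close>, which act from the right by composition.\<close>

definition mult_module ::
    "('x, 'a::cstar_algebra) hmod \<Rightarrow> ('a \<Rightarrow> 'x, 'a \<Rightarrow> 'a) hmod" where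
  "mult_module X = \<lparr>hcarrier = adjointable self_module X,
                    hact = (\<lambda>v m. v \<circ> m),
                    hip = (\<lambda>v w. adj self_module X v \<circ> w)\<rparr>"

definition mult_embed :: "('x, 'a) hmod \<Rightarrow> 'x \<Rightarrow> 'a \<Rightarrow> 'x" where
  "mult_embed X x = (\<lambda>a. hact X x a)"

text \<open>The \<open>'a\<close>-valued inner product \<open>\<langle>v, x\<rangle> = v\<^sup>* x\<close> for \<open>v \<in> M(X)\<close> and \<open>x \<in> X\<close>. The lemmas \<open>mip_eq\<close>
  and \<open>mip_embed\<close> relate it to the inner products of \<open>M(X)\<close> and \<open>X\<close>.\<close>

definition mip :: "('x, 'a::cstar_algebra) hmod \<Rightarrow> ('a \<Rightarrow> 'x) \<Rightarrow> 'x \<Rightarrow> 'a" where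
  "mip X v x = adj self_module X v x"

lemma cstar_eqI:
  fixes d e :: "'a::cstar_algebra"
  assumes "\<And>c. c\<^sup>\<star> * d = c\<^sup>\<star> * e"
  shows "d = e"
proof -
  have "(d - e)\<^sup>\<star> * (d - e) = 0"
    using assms[of "d - e"] by (simp add: right_diff_distrib)
  then have "(norm (d - e))\<^sup>2 = 0"
    using norm_cstar_mult[of "d - e"] by simp
  then show ?thesis by simp
qed

lemma mip_adjoint:
  assumes "v \<in> hcarrier (mult_module X)" "x \<in> hcarrier X"
  shows "hip X (v c) x = c\<^sup>\<star> * mip X v x"
proof -
  have "\<exists>S. is_adjoint self_module X v S"
    using assms(1) by (simp add: mult_module_def adjointable_def)
  then have "is_adjoint self_module X v (adj self_module X v)"
    unfolding adj_def by (rule someI_ex)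
  then show ?thesis
    using assms(2) by (simp add: is_adjoint_def self_module_def mip_def)
qed

context hilbert_module
begin

lemma mip_unique:
  assumes "v \<in> hcarrier (mult_module X)" "x \<in> hcarrier X"
    and "\<And>c. hip X (v c) x = c\<^sup>\<star> * a"
  shows "mip X v x = a"
  by (rule cstar_eqI) (simp only: assms(3) flip: mip_adjoint[OF assms(1,2)])

lemma embed_in_mult_module:
  assumes "x \<in> hcarrier X"
  shows "mult_embed X x \<in> hcarrier (mult_module X)"
proof -
  have "is_adjoint self_module X (mult_embed X x) (hip X x)"
    unfolding is_adjoint_def
  proof (intro conjI ballI)
    fix a y assume "y \<in> hcarrier X"
    then have "hip X (hact X x a) y = (hip X y (hact X x a))\<^sup>\<star>"
      using assms act_closed ip_sym by blast
    also have "\<dots> = a\<^sup>\<star> * hip X x y"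
      using assms \<open>y \<in> hcarrier X\<close> by (simp only: ip_act_right cstar_mult ip_sym[of y x])
    finally show "hip X (mult_embed X x a) y = hip self_module a (hip X x y)"
      by (simp add: mult_embed_def self_module_def)
  qed (simp add: self_module_def)
  then show ?thesis
    using assms act_closed
    by (auto simp: mult_module_def adjointable_def mult_embed_def)
qed

lemma mip_embed:
  assumes "y \<in> hcarrier X" "x \<in> hcarrier X"
  shows "mip X (mult_embed X y) x = hip X y x"
proof (rule mip_unique[OF embed_in_mult_module[OF assms(1)] assms(2)])
  fix c
  have "hip X (hact X y c) x = (hip X x (hact X y c))\<^sup>\<star>"
    using assms act_closed ip_sym by blast
  also have "\<dots> = c\<^sup>\<star> * hip X y x"
    using assms by (simp only: ip_act_right cstar_mult ip_sym[of x y])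
  finally show "hip X (mult_embed X y c) x = c\<^sup>\<star> * hip X y x"
    by (simp add: mult_embed_def)
qed

lemma mip_eq:
  assumes "v \<in> hcarrier (mult_module X)" "x \<in> hcarrier X"
  shows "hip (mult_module X) v (mult_embed X x) = (\<lambda>a. mip X v x * a)"
proof
  fix a
  have "v c \<in> hcarrier X" for c
    using assms(1) by (auto simp: mult_module_def adjointable_def self_module_def)
  then have "hip X (v c) (hact X x a) = c\<^sup>\<star> * (mip X v x * a)" for c
    using assms mip_adjoint[OF assms] by (simp add: ip_act_right mult.assoc)
  then have "mip X v (hact X x a) = mip X v x * a"
    using assms act_closed by (intro mip_unique) auto
  then show "hip (mult_module X) v (mult_embed X x) a = mip X v x * a"
    by (simp add: mult_module_def mult_embed_def mip_def)
qed

end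


section \<open>Frames and Bessel sequences\<close>

text \<open>The argument \<open>t x n\<close> is the term \<open>\<langle>x, x\<^sub>n\<rangle>\<langle>x\<^sub>n, x\<rangle>\<close>.\<close>

definition bessel_ineq ::
    "('x, 'a::cstar_algebra) hmod \<Rightarrow> ('x \<Rightarrow> nat \<Rightarrow> 'a) \<Rightarrow> bool" where
  "bessel_ineq X t \<longleftrightarrow>
     (\<exists>B>0. \<forall>x\<in>hcarrier X. summable (t x) \<and> (\<Sum>n. t x n) \<preceq> B *\<^sub>R hip X x x)"

definition frame_ineq ::
    "('x, 'a::cstar_algebra) hmod \<Rightarrow> ('x \<Rightarrow> nat \<Rightarrow> 'a) \<Rightarrow> bool" where
  "frame_ineq X t \<longleftrightarrow>
     (\<exists>A>0. \<exists>B>0. \<forall>x\<in>hcarrier X. summable (t x) \<and>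
        A *\<^sub>R hip X x x \<preceq> (\<Sum>n. t x n) \<and> (\<Sum>n. t x n) \<preceq> B *\<^sub>R hip X x x)"

definition bessel_seq :: "('x, 'a::cstar_algebra) hmod \<Rightarrow> (nat \<Rightarrow> 'x) \<Rightarrow> bool" where
  "bessel_seq X y \<longleftrightarrow> (\<forall>n. y n \<in> hcarrier X) \<and>
     bessel_ineq X (\<lambda>x n. hip X x (y n) * hip X (y n) x)"

definition frame :: "('x, 'a::cstar_algebra) hmod \<Rightarrow> (nat \<Rightarrow> 'x) \<Rightarrow> bool" where
  "frame X y \<longleftrightarrow> (\<forall>n. y n \<in> hcarrier X) \<and>
     frame_ineq X (\<lambda>x n. hip X x (y n) * hip X (y n) x)"

definition outer_seq :: "('x, 'a::cstar_algebra) hmod \<Rightarrow> (nat \<Rightarrow> 'a \<Rightarrow> 'x) \<Rightarrow> bool" where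
  "outer_seq X v \<longleftrightarrow> (\<forall>n. v n \<in> hcarrier (mult_module X)) \<and>
     (\<exists>n. v n \<notin> mult_embed X ` hcarrier X)"

definition outer_bessel_seq :: "('x, 'a::cstar_algebra) hmod \<Rightarrow> (nat \<Rightarrow> 'a \<Rightarrow> 'x) \<Rightarrow> bool" where
  "outer_bessel_seq X v \<longleftrightarrow> outer_seq X v \<and>
     bessel_ineq X (\<lambda>x n. (mip X (v n) x)\<^sup>\<star> * mip X (v n) x)"

definition outer_frame :: "('x, 'a::cstar_algebra) hmod \<Rightarrow> (nat \<Rightarrow> 'a \<Rightarrow> 'x) \<Rightarrow> bool" where
  "outer_frame X v \<longleftrightarrow> outer_seq X v \<and>
     frame_ineq X (\<lambda>x n. (mip X (v n) x)\<^sup>\<star> * mip X (v n) x)"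

text \<open>For sequences in \<open>M(X)\<close>, with \<open>X\<close> regarded as a submodule of \<open>M(X)\<close> via \<open>mult_embed X\<close>.\<close>

definition bessel_or_outer_bessel ::
    "('x, 'a::cstar_algebra) hmod \<Rightarrow> (nat \<Rightarrow> 'a \<Rightarrow> 'x) \<Rightarrow> bool" where
  "bessel_or_outer_bessel X v \<longleftrightarrow>
     (\<exists>y. bessel_seq X y \<and> v = (\<lambda>n. mult_embed X (y n))) \<or> outer_bessel_seq X v"

definition frame_or_outer_frame ::
    "('x, 'a::cstar_algebra) hmod \<Rightarrow> (nat \<Rightarrow> 'a \<Rightarrow> 'x) \<Rightarrow> bool" where
  "frame_or_outer_frame X v \<longleftrightarrow>
     (\<exists>y. frame X y \<and> v = (\<lambda>n. mult_embed X (y n))) \<or> outer_frame X v"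

definition analysis_op ::
    "('x, 'a::cstar_algebra) hmod \<Rightarrow> (nat \<Rightarrow> 'a \<Rightarrow> 'x) \<Rightarrow> 'x \<Rightarrow> nat \<Rightarrow> 'a" where
  "analysis_op X v = (\<lambda>x n. mip X (v n) x)"

text \<open>The empty list is admitted as an extension; adjoining a zero vector does not affect
  whether a sequence is a frame or an outer frame.\<close>

definition prepend :: "'z list \<Rightarrow> (nat \<Rightarrow> 'z) \<Rightarrow> nat \<Rightarrow> 'z" where
  "prepend fs v = (\<lambda>n. if n < length fs then fs ! n else v (n - length fs))"

definition is_finite_extension ::
    "('x, 'a::cstar_algebra) hmod \<Rightarrow> (nat \<Rightarrow> 'a \<Rightarrow> 'x) \<Rightarrow> ('a \<Rightarrow> 'x) list \<Rightarrow> bool" where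
  "is_finite_extension X v fs \<longleftrightarrow>
     set fs \<subseteq> hcarrier (mult_module X) \<and> frame_or_outer_frame X (prepend fs v)"

end

theory Submission
  imports Defs
begin

text \<open>If \<open>x = V\<^sup>* U x + \<Sum> w\<^sub>i \<langle>z\<^sub>i, x\<rangle>\<close>, then adjoining the \<open>z\<^sub>i\<close> gives a frame: \<open>\<langle>x, x\<rangle>\<close> becomes a pairing of
  \<open>(w\<^sub>i\<^sup>* x, V x)\<close> with the coefficients \<open>(z\<^sub>i\<^sup>* x, U x)\<close> of \<open>x\<close>, and the arithmetic-geometric mean inequality
  bounds \<open>\<langle>x, x\<rangle>\<close> by the latter. Conversely, if \<open>T\<close> is the analysis operator of the extended frame, then
  \<open>S = T\<^sup>* T\<close> is invertible and \<open>x = S\<^sup>-\<^sup>1 T\<^sup>* T x\<close>; the finitely many new vectors contribute a finite rank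
  operator and the remaining ones contribute \<open>V\<^sup>* U x\<close>.

  Both directions rest on two general facts. That the elements \<open>c\<^sup>\<star> c\<close> form a closed convex cone is proved
  in the unitization, without spectral theory. That \<open>\<langle>T x, T x\<rangle> \<preceq> K \<langle>x, x\<rangle>\<close> for adjointable \<open>T\<close> follows
  from the boundedness of the everywhere defined symmetric operator \<open>T\<^sup>* T\<close>.\<close>

text \<open>The relation \<open>a \<preceq> b\<close> asks for one element \<open>c\<close>, so
  already its transitivity needs a sum of two elements \<open>c\<^sup>\<star> * c\<close> to have
  that form again. The square roots that supply \<open>c\<close> are built from
  \<open>1 - a\<close>, hence the unit; the results descend because a root of an element of
  \<open>'a\<close> has scalar part 0. For \<open>spec_nonneg\<close>, sums and limits are plain
  norm estimates; the hard point is that \<open>c\<^sup>\<star> * c\<close> satisfies it.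
  Adjointable maps carry no bound by definition, while the frame inequalities compare algebra
  elements and not norms. So a norm bound has to be extracted from the mere existence of an adjoint
  and then sharpened to an order inequality. For the converse, let \<open>Q\<close> be the inverse
  of \<open>S\<close>. Moving \<open>Q\<close> across the inner product in
  \<open>x = Q (S x)\<close> dictates the choice: \<open>V\<close> is the part of \<open>T Q\<close>
  that belongs to the old vectors, and the finite rank operator pairs each new vector
  \<open>u i\<close> with \<open>Q\<close> applied to it. As \<open>'a\<close> may lack a unit,
  identities in M(X) are evaluated at every element of \<open>'a\<close> and pulled back to X by
  injectivity of \<open>mult_embed\<close>.\<close>

section \<open>Isometry and continuity of the involution\<close>

lemma cstar_zero [simp]: "(0::'a::cstar_algebra)\<^sup>\<star> = 0"
  using cstar_add[of "0::'a" 0] by simp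

lemma cstar_minus: "(- x)\<^sup>\<star> = - (x\<^sup>\<star>)" for x :: "'a::cstar_algebra"
  using cstar_add[of x "- x"] by (simp add: eq_neg_iff_add_eq_0 add.commute)

lemma cstar_diff: "(x - y)\<^sup>\<star> = x\<^sup>\<star> - y\<^sup>\<star>" for x :: "'a::cstar_algebra"
  using cstar_add[of x "- y"] by (simp add: cstar_minus)

lemma cstar_scaleR: "(r *\<^sub>R x)\<^sup>\<star> = r *\<^sub>R x\<^sup>\<star>" for x :: "'a::cstar_algebra"
  by (simp add: cstar_scaleC flip: scaleC_of_real)

text \<open>Submultiplicativity turns \<open>norm_cstar_mult\<close> into one inequality; applying
  it to the adjoint gives the other.\<close>

lemma norm_cstar [simp]: "norm (x\<^sup>\<star>) = norm x" for x :: "'a::cstar_algebra"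
proof -
  have le: "norm y \<le> norm (y\<^sup>\<star>)" for y :: 'a
  proof (cases "y = 0")
    case False
    have "norm y * norm y \<le> norm (y\<^sup>\<star>) * norm y"
      using norm_mult_ineq[of "y\<^sup>\<star>" y] by (simp add: norm_cstar_mult power2_eq_square)
    then show ?thesis using False by simp
  qed simp
  show ?thesis using le[of x] le[of "x\<^sup>\<star>"] by (simp add: cstar_cstar)
qed

lemma bounded_linear_cstar: "bounded_linear (cstar :: 'a::cstar_algebra \<Rightarrow> 'a)"
  by (rule bounded_linear_intro[where K = 1]) (simp_all add: cstar_add cstar_scaleR)

lemmas tendsto_cstar = bounded_linear.tendsto[OF bounded_linear_cstar]

lemma cstar_sum: "(\<Sum>i\<in>I. f i)\<^sup>\<star> = (\<Sum>i\<in>I. (f i :: 'a::cstar_algebra)\<^sup>\<star>)"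
  by (rule linear_sum[OF bounded_linear.linear[OF bounded_linear_cstar]])

lemma cstar_mult_self_eq_0_iff [simp]: "x\<^sup>\<star> * x = 0 \<longleftrightarrow> x = 0" for x :: "'a::cstar_algebra"
  using norm_cstar_mult[of x] by auto

section \<open>Positivity in unital algebras\<close>

text \<open>The condition \<open>norm 1 = 1\<close> excludes the zero algebra; the unitization
  satisfies it even over the zero algebra.\<close>

class cstar_algebra_1 = cstar_algebra + real_normed_algebra_1

lemma cstar_one [simp]: "(1::'a::cstar_algebra_1)\<^sup>\<star> = 1"
  using cstar_mult[of "1::'a" "1\<^sup>\<star>"] by (simp add: cstar_cstar)

text \<open>Square roots come from the iteration \<open>s \<mapsto> ((1 - a) + s\<^sup>2) / 2\<close> for \<open>1 - sqrt a\<close>, which is dominated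
  termwise by the same iteration for \<open>a = 0\<close>.\<close>

lemma selfadjoint_sqrt:
  fixes a :: "'a::cstar_algebra_1"
  assumes sa: "a\<^sup>\<star> = a" and le: "norm (1 - a) \<le> 1"
  obtains w where "w\<^sup>\<star> = w" "w * w = a" "norm (1 - w) \<le> 1" "\<And>y. y * a = a * y \<Longrightarrow> y * w = w * y"
proof -
  define x where "x = 1 - a"
  define s where "s = rec_nat (0::'a) (\<lambda>_ s. (1/2) *\<^sub>R (x + s * s))"
  define r where "r = rec_nat (0::real) (\<lambda>_ r. (1/2) * (1 + r * r))"
  have s: "s 0 = 0" "s (Suc n) = (1/2) *\<^sub>R (x + s n * s n)" for n by (simp_all add: s_def)
  have r: "r 0 = 0" "r (Suc n) = (1/2) * (1 + r n * r n)" for n by (simp_all add: r_def)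
  have nx: "norm x \<le> 1" using le by (simp add: x_def)
  have xsa: "x\<^sup>\<star> = x" by (simp add: x_def sa cstar_diff)
  have ssa: "(s n)\<^sup>\<star> = s n" for n
    by (induction n) (simp_all add: s xsa cstar_scaleR cstar_add cstar_mult)
  have comm: "y * s n = s n * y" if "y * x = x * y" for y n
  proof (induction n)
    case (Suc n)
    have "y * (s n * s n) = (s n * s n) * y" by (metis Suc mult.assoc)
    then show ?case by (simp add: s that distrib_left distrib_right)
  qed (simp add: s)
  have comm2: "s m * s n = s n * s m" for m n
    by (metis comm)
  have r01: "0 \<le> r n \<and> r n \<le> 1" for n
  proof (induction n)
    case (Suc n)
    then have "r n * r n \<le> 1" by (simp add: mult_le_one)
    then show ?case by (simp add: r)
  qed (simp add: r)
  have sr: "norm (s n) \<le> r n" for n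
  proof (induction n)
    case (Suc n)
    have "norm (s n * s n) \<le> r n * r n"
      using Suc by (meson mult_mono norm_ge_zero norm_mult_ineq order_trans r01)
    then show ?case using nx norm_triangle_ineq[of x "s n * s n"] by (simp add: s r)
  qed (simp add: s r)
  \<comment> \<open>The increments must be dominated, not only the iterates: a difference of squares
    factors because all \<open>s n\<close> commute, and the telescoping series of \<open>r\<close>
    then majorizes that of \<open>s\<close>.\<close>
  have diff: "norm (s (Suc n) - s n) \<le> r (Suc n) - r n" for n
  proof (induction n)
    case 0 then show ?case using nx by (simp add: s r)
  next
    case (Suc n)
    have "s (Suc (Suc n)) - s (Suc n) = (1/2) *\<^sub>R ((s (Suc n) - s n) * (s (Suc n) + s n))"
    proof -
      have "s (Suc (Suc n)) - s (Suc n) = (1/2) *\<^sub>R (s (Suc n) * s (Suc n) - s n * s n)"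
        by (subst s(2)[of "Suc n"], subst (3) s(2)) (simp flip: scaleR_right_diff_distrib)
      also have "s (Suc n) * s (Suc n) - s n * s n = (s (Suc n) - s n) * (s (Suc n) + s n)"
        using comm2[of n "Suc n"] by (simp only: ring_distribs) simp
      finally show ?thesis .
    qed
    also have "norm \<dots> \<le> (1/2) * ((r (Suc n) - r n) * (r (Suc n) + r n))"
    proof -
      have "norm (s (Suc n) + s n) \<le> r (Suc n) + r n"
        using norm_triangle_ineq[of "s (Suc n)" "s n"] sr[of n] sr[of "Suc n"] by linarith
      then have "norm (s (Suc n) - s n) * norm (s (Suc n) + s n)
        \<le> (r (Suc n) - r n) * (r (Suc n) + r n)"
        by (intro mult_mono Suc order_trans[OF norm_ge_zero Suc] norm_ge_zero)
      then show ?thesis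
        using norm_mult_ineq[of "s (Suc n) - s n" "s (Suc n) + s n"] by simp
    qed
    also have "\<dots> = r (Suc (Suc n)) - r (Suc n)"
      by (subst r(2)[of "Suc n"], subst (5) r(2)) (simp add: field_simps)
    finally show ?case .
  qed
  have "incseq r"
    by (rule incseq_SucI) (use diff norm_ge_zero in \<open>smt (verit)\<close>)
  then have "convergent r"
    using r01 by (metis convergentI incseq_convergent)
  then have "summable (\<lambda>n. r (Suc n) - r n)"
    unfolding convergent_def using telescope_summable by blast
  then have "summable (\<lambda>n. s (Suc n) - s n)"
    by (rule summable_comparison_test[rotated]) (use diff in auto)
  then have "convergent (\<lambda>n. \<Sum>i<n. s (Suc i) - s i)"
    by (simp add: summable_iff_convergent)
  then obtain l where l: "s \<longlonglongrightarrow> l"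
    unfolding sum_lessThan_telescope by (auto simp: s(1) convergent_def)
  have "(\<lambda>n. s (Suc n)) \<longlonglongrightarrow> (1/2) *\<^sub>R (x + l * l)"
    unfolding s by (intro tendsto_intros l)
  then have lfix: "l = (1/2) *\<^sub>R (x + l * l)"
    using LIMSEQ_unique LIMSEQ_Suc[OF l] by blast
  have lsa: "l\<^sup>\<star> = l"
    using tendsto_cstar[OF l] unfolding ssa by (rule LIMSEQ_unique[OF _ l])
  have lcomm: "y * l = l * y" if "y * x = x * y" for y
  proof (rule LIMSEQ_unique)
    show "(\<lambda>n. y * s n) \<longlonglongrightarrow> y * l" by (intro tendsto_intros l)
    show "(\<lambda>n. y * s n) \<longlonglongrightarrow> l * y" unfolding comm[OF that] by (intro tendsto_intros l)
  qed
  have nl: "norm l \<le> 1"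
    by (rule Lim_bounded[OF tendsto_norm[OF l]]) (use sr r01 order_trans in blast)
  have "2 *\<^sub>R l = x + l * l" by (subst lfix) simp
  then have "(1 - l) * (1 - l) = a"
    by (simp add: x_def algebra_simps scaleR_2)
  moreover have "y * (1 - l) = (1 - l) * y" if "y * a = a * y" for y
  proof -
    have "y * x = x * y" using that by (simp add: x_def algebra_simps)
    then show ?thesis using lcomm by (simp add: algebra_simps)
  qed
  moreover have "(1 - l)\<^sup>\<star> = 1 - l" "norm (1 - (1 - l)) \<le> 1" using lsa nl by (simp_all add: cstar_diff)
  ultimately show ?thesis using that[of "1 - l"] by blast
qed

text \<open>Two commuting self-adjoint elements \<open>v, w\<close> with \<open>v\<^sup>2 + w\<^sup>2 = 1\<close> make \<open>v + \<i> w\<close> unitary.\<close>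

lemma norm_le_1_of_circle:
  fixes v w :: "'a::cstar_algebra_1"
  assumes v: "v\<^sup>\<star> = v" and w: "w\<^sup>\<star> = w" and comm: "v * w = w * v" and 1: "v * v + w * w = 1"
  shows "norm v \<le> 1"
proof -
  define u where "u = v + \<i> *c w"
  have us: "u\<^sup>\<star> = v - \<i> *c w"
  proof -
    have "cnj \<i> *c w = - (\<i> *c w)" by (simp add: complex_vector.scale_minus_left)
    then show ?thesis by (simp add: u_def cstar_add cstar_scaleC v w)
  qed
  have "u\<^sup>\<star> * u = v * v + w * w"
    unfolding us unfolding u_def
    by (simp add: algebra_simps scaleC_mult_left scaleC_mult_right comm scaleC_scaleC
        complex_vector.scale_minus_left scaleC_one)
  then have "(norm u)\<^sup>2 = 1" using norm_cstar_mult[of u] by (simp add: 1)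
  then have "norm u = 1" by (simp add: power2_eq_1_iff norm_eq_zero) (use norm_ge_zero[of u] in linarith)
  moreover have "u + u\<^sup>\<star> = 2 *\<^sub>R v" unfolding us unfolding u_def by (simp add: scaleR_2)
  ultimately show ?thesis
    using norm_triangle_ineq[of u "u\<^sup>\<star>"] by simp
qed

text \<open>A spectrum-free form of \<open>a\<close> being self-adjoint with non-negative spectrum.\<close>

definition spec_nonneg :: "'a::cstar_algebra_1 \<Rightarrow> bool" where
  "spec_nonneg a \<longleftrightarrow> a\<^sup>\<star> = a \<and> (\<exists>t\<ge>0. norm (t *\<^sub>R 1 - a) \<le> t)"

lemma spec_nonneg_sa: "spec_nonneg a \<Longrightarrow> a\<^sup>\<star> = a"
  by (simp add: spec_nonneg_def)

text \<open>The gain of this form of positivity: the radii \<open>s\<close> and \<open>t\<close> add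
  by the triangle inequality, and no root of a sum of squares has to be found.\<close>

lemma spec_nonneg_add:
  assumes "spec_nonneg a" "spec_nonneg b" shows "spec_nonneg (a + b)"
proof -
  obtain s t where st: "s \<ge> 0" "norm (s *\<^sub>R 1 - a) \<le> s" "t \<ge> 0" "norm (t *\<^sub>R 1 - b) \<le> t"
    using assms by (auto simp: spec_nonneg_def)
  have "norm ((s + t) *\<^sub>R 1 - (a + b)) \<le> s + t"
    using norm_triangle_ineq[of "s *\<^sub>R 1 - a" "t *\<^sub>R 1 - b"] st by (simp add: algebra_simps)
  then show ?thesis
    using assms st(1,3) by (auto simp: spec_nonneg_def cstar_add intro!: exI[of _ "s + t"])
qed

lemma spec_nonneg_scaleR:
  assumes "spec_nonneg a" "r \<ge> 0" shows "spec_nonneg (r *\<^sub>R a)"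
proof -
  obtain t where t: "t \<ge> 0" "norm (t *\<^sub>R 1 - a) \<le> t"
    using assms by (auto simp: spec_nonneg_def)
  have "norm ((r * t) *\<^sub>R 1 - r *\<^sub>R a) = r * norm (t *\<^sub>R 1 - a)"
    using assms(2) by (simp flip: scaleR_scaleR scaleR_right_diff_distrib)
  then have "norm ((r * t) *\<^sub>R 1 - r *\<^sub>R a) \<le> r * t"
    using t assms(2) by (simp add: mult_left_mono)
  then show ?thesis
    using assms t by (auto simp: spec_nonneg_def cstar_scaleR intro!: exI[of _ "r * t"])
qed

text \<open>Division by \<open>t\<close> reduces to \<open>selfadjoint_sqrt\<close>. Its bound
  \<open>norm (1 - w) \<le> 1\<close> is exactly what makes the root \<open>spec_nonneg\<close>
  again, with witness 1.\<close>

lemma spec_nonneg_sqrt: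
  fixes a :: "'a::cstar_algebra_1"
  assumes "spec_nonneg a"
  obtains w where "w\<^sup>\<star> = w" "w * w = a" "spec_nonneg w" "\<And>y. y * a = a * y \<Longrightarrow> y * w = w * y"
proof -
  obtain t where t: "t \<ge> 0" "norm (t *\<^sub>R 1 - a) \<le> t"
    using assms by (auto simp: spec_nonneg_def)
  show ?thesis
  proof (cases "t = 0")
    case True
    then have "a = 0" using t by simp
    then show ?thesis by (intro that[of 0]) (auto simp: spec_nonneg_def)
  next
    case False
    then have tp: "t > 0" using t by simp
    have "1 - (1/t) *\<^sub>R a = (1/t) *\<^sub>R (t *\<^sub>R 1 - a)" using tp by (simp add: scaleR_right_diff_distrib)
    then have "norm (1 - (1/t) *\<^sub>R a) \<le> 1" using t tp by simp
    moreover have "((1/t) *\<^sub>R a)\<^sup>\<star> = (1/t) *\<^sub>R a"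
      using assms by (simp add: cstar_scaleR spec_nonneg_def)
    ultimately obtain w where w: "w\<^sup>\<star> = w" "w * w = (1/t) *\<^sub>R a" "norm (1 - w) \<le> 1"
      "\<And>y. y * ((1/t) *\<^sub>R a) = ((1/t) *\<^sub>R a) * y \<Longrightarrow> y * w = w * y"
      using selfadjoint_sqrt[of "(1/t) *\<^sub>R a"] by blast
    have "spec_nonneg w" using w(1,3) by (auto simp: spec_nonneg_def intro!: exI[of _ 1])
    then have "spec_nonneg (sqrt t *\<^sub>R w)" by (rule spec_nonneg_scaleR) (use t in simp)
    moreover have "y * (sqrt t *\<^sub>R w) = (sqrt t *\<^sub>R w) * y" if "y * a = a * y" for y
      using w(4)[of y] that by simp
    moreover have "(sqrt t *\<^sub>R w)\<^sup>\<star> = sqrt t *\<^sub>R w" by (simp add: cstar_scaleR w(1))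
    moreover have "(sqrt t *\<^sub>R w) * (sqrt t *\<^sub>R w) = a" using tp by (simp add: w(2))
    ultimately show ?thesis by (rule that[rotated 2])
  qed
qed

text \<open>A contraction \<open>w\<close> has a partner \<open>v\<close> with
  \<open>v * v = 1 - w * w\<close> that commutes with \<open>w\<close>, so the two lie on the
  circle. Hence \<open>v\<close> is a contraction, and so is its square.\<close>

lemma norm_one_diff_square_le:
  fixes w :: "'a::cstar_algebra_1"
  assumes w: "w\<^sup>\<star> = w" and "norm w \<le> 1"
  shows "norm (1 - w * w) \<le> 1"
proof -
  have "norm (w * w) \<le> 1"
    using assms norm_cstar_mult[of w] by (simp add: power_le_one)
  then have "norm (1 - (1 - w * w)) \<le> 1" by simp
  moreover have "(1 - w * w)\<^sup>\<star> = 1 - w * w" by (simp add: cstar_diff cstar_mult w)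
  ultimately obtain v where v: "v\<^sup>\<star> = v" "v * v = 1 - w * w"
    "\<And>y. y * (1 - w * w) = (1 - w * w) * y \<Longrightarrow> y * v = v * y"
    using selfadjoint_sqrt[of "1 - w * w"] by blast
  have "w * v = v * w" by (rule v(3)) (simp add: algebra_simps)
  then have "norm v \<le> 1" using norm_le_1_of_circle[OF v(1) w] v(2) by simp
  then have "(norm v)\<^sup>2 \<le> 1" by (simp add: power_le_one)
  then show ?thesis using norm_cstar_mult[of v] v(1,2) by simp
qed

lemma norm_diff_le_of_square:
  fixes w :: "'a::cstar_algebra_1"
  assumes w: "w\<^sup>\<star> = w" and t: "norm (w * w) \<le> t"
  shows "norm (t *\<^sub>R 1 - w * w) \<le> t"
proof (cases "t = 0")
  case False
  then have tp: "t > 0" using t norm_ge_zero order_trans by (metis less_le)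
  define u where "u = (1 / sqrt t) *\<^sub>R w"
  have usa: "u\<^sup>\<star> = u" by (simp add: u_def w cstar_scaleR)
  have uu: "u * u = (1/t) *\<^sub>R (w * w)" using tp by (simp add: u_def)
  have "(norm u)\<^sup>2 \<le> 1"
    unfolding norm_cstar_mult[symmetric] usa uu using t tp by simp
  then have "norm u \<le> 1" by (simp add: power_le_one_iff)
  then have "norm (1 - (1/t) *\<^sub>R (w * w)) \<le> 1"
    using norm_one_diff_square_le[OF usa] uu by simp
  moreover have "t *\<^sub>R 1 - w * w = t *\<^sub>R (1 - (1/t) *\<^sub>R (w * w))"
    using tp by (simp add: scaleR_right_diff_distrib)
  ultimately show ?thesis using tp by simp
qed (use t in simp)

lemma spec_nonneg_square:
  fixes w :: "'a::cstar_algebra_1"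
  assumes "w\<^sup>\<star> = w" shows "spec_nonneg (w * w)"
  unfolding spec_nonneg_def
  using norm_diff_le_of_square[OF assms order_refl] norm_ge_zero[of "w * w"]
  by (metis assms cstar_mult)

text \<open>Every bound of the norm serves as the existential witness in \<open>spec_nonneg\<close>,
  because \<open>a\<close> is a square. This uniformity yields closedness: one \<open>t\<close>
  works for a whole convergent sequence.\<close>

lemma spec_nonneg_norm_le:
  assumes "spec_nonneg a" "norm a \<le> t" shows "norm (t *\<^sub>R 1 - a) \<le> t"
proof -
  obtain w where "w\<^sup>\<star> = w" "w * w = a" using spec_nonneg_sqrt[OF assms(1)] .
  then show ?thesis using norm_diff_le_of_square assms(2) by blast
qed

lemma spec_nonneg_closed:
  fixes a :: "nat \<Rightarrow> 'a::cstar_algebra_1"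
  assumes pos: "\<And>n. spec_nonneg (a n)" and lim: "a \<longlonglongrightarrow> l"
  shows "spec_nonneg l"
proof -
  obtain t where t: "\<And>n. norm (a n) \<le> t"
    using convergent_imp_Bseq[OF convergentI[OF lim]] unfolding Bseq_def by blast
  have "norm (t *\<^sub>R 1 - l) \<le> t"
  proof (rule Lim_bounded)
    show "(\<lambda>n. norm (t *\<^sub>R 1 - a n)) \<longlonglongrightarrow> norm (t *\<^sub>R 1 - l)" by (intro tendsto_intros lim)
  qed (use pos t spec_nonneg_norm_le in blast)
  moreover have "l\<^sup>\<star> = l"
    using tendsto_cstar[OF lim] unfolding spec_nonneg_sa[OF pos] by (rule LIMSEQ_unique[OF _ lim])
  moreover have "t \<ge> 0" using t[of 0] norm_ge_zero order_trans by blast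
  ultimately show ?thesis by (auto simp: spec_nonneg_def)
qed

text \<open>For \<open>t > norm b\<close> both \<open>a\<close> and \<open>t *\<^sub>R 1 - a\<close>
  have roots, which commute; divided by \<open>sqrt t\<close> they lie on the circle, so the root of
  \<open>a\<close> has norm at most \<open>sqrt t\<close>. The slack \<open>e\<close> keeps
  \<open>t\<close> positive.\<close>

lemma spec_nonneg_norm_mono:
  fixes a b :: "'a::cstar_algebra_1"
  assumes a: "spec_nonneg a" and ba: "spec_nonneg (b - a)"
  shows "norm a \<le> norm b"
proof (rule field_le_epsilon)
  fix e :: real assume "e > 0"
  define t where "t = norm b + e"
  have t: "t > 0" "norm b \<le> t" using \<open>e > 0\<close> by (simp_all add: t_def add_nonneg_pos)
  have bsa: "b\<^sup>\<star> = b" using spec_nonneg_sa[OF spec_nonneg_add[OF a ba]] by simp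
  have "spec_nonneg (t *\<^sub>R 1 - b)"
    using t bsa by (auto simp: spec_nonneg_def cstar_diff cstar_scaleR intro!: exI[of _ t])
  from spec_nonneg_add[OF this ba] have "spec_nonneg (t *\<^sub>R 1 - a)" by simp
  then obtain v where v: "v\<^sup>\<star> = v" "v * v = t *\<^sub>R 1 - a"
     "\<And>y. y * (t *\<^sub>R 1 - a) = (t *\<^sub>R 1 - a) * y \<Longrightarrow> y * v = v * y"
    using spec_nonneg_sqrt by blast
  obtain w where w: "w\<^sup>\<star> = w" "w * w = a" using spec_nonneg_sqrt[OF a] .
  have vw: "w * v = v * w" by (rule v(3)) (simp add: algebra_simps mult.assoc flip: w(2))
  have "norm ((1 / sqrt t) *\<^sub>R w) \<le> 1"
  proof (rule norm_le_1_of_circle)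
    show "((1 / sqrt t) *\<^sub>R w) * ((1 / sqrt t) *\<^sub>R w) + ((1 / sqrt t) *\<^sub>R v) * ((1 / sqrt t) *\<^sub>R v) = 1"
      using t by (simp add: v(2) w(2) flip: scaleR_right_distrib)
  qed (simp_all add: cstar_scaleR v(1) w(1) vw)
  then have "norm w \<le> sqrt t" using t by (simp add: field_simps)
  then have "(norm w)\<^sup>2 \<le> t" using t by (metis norm_ge_zero power_mono real_sqrt_pow2 less_imp_le)
  then show "norm a \<le> norm b + e" using norm_cstar_mult[of w] w by (simp add: t_def)
qed

section \<open>Positivity of \<open>c\<^sup>\<star> * c\<close> in a unital algebra\<close>

text \<open>Takes the place of the spectral radius formula: for self-adjoint \<open>y\<close> the
  norm is multiplicative along the powers \<open>2 ^ k\<close>, and exponential growth contradicts a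
  linear bound.\<close>

lemma selfadjoint_norm_le_1_of_growth:
  fixes y :: "'a::cstar_algebra_1"
  assumes y: "y\<^sup>\<star> = y" and le: "\<And>n. norm (y ^ n) \<le> 1 + real n * C"
  shows "norm y \<le> 1"
proof (rule ccontr)
  assume "\<not> norm y \<le> 1"
  then have y1: "1 < norm y" by simp
  have sa: "(y ^ n)\<^sup>\<star> = y ^ n" for n
  proof (induction n)
    case (Suc n)
    then show ?case by (simp only: power_Suc cstar_mult y power_commutes)
  qed simp
  have pow: "norm (y ^ (2 ^ k)) = norm y ^ (2 ^ k)" for k
  proof (induction k)
    case (Suc k)
    have "norm (y ^ (2 ^ Suc k)) = norm ((y ^ (2 ^ k))\<^sup>\<star> * y ^ (2 ^ k))"
      unfolding sa power_Suc mult_2 power_add ..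
    also have "\<dots> = (norm y ^ (2 ^ k))\<^sup>2" unfolding norm_cstar_mult Suc ..
    also have "\<dots> = norm y ^ (2 ^ Suc k)"
      unfolding power_Suc mult_2 power_add power2_eq_square ..
    finally show ?case .
  qed simp
  define c where "c = norm y - 1"
  have c: "c > 0" using y1 by (simp add: c_def)
  define K where "K = max C 0 + 1"
  \<comment> \<open>Bernoulli's inequality for \<open>n\<close> itself is only linear and would not
    beat the linear bound; squaring it at \<open>n / 2\<close> gives quadratic growth.\<close>
  have bern: "norm y ^ n \<ge> (real n * c / 2)\<^sup>2" if "even n" for n
  proof -
    obtain m where m: "n = m * 2" using \<open>even n\<close> by (metis dvd_mult_div_cancel mult.commute)
    have "1 + real m * c \<le> (1 + c) ^ m" using c by (intro Bernoulli_inequality) simp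
    then have "real m * c \<le> norm y ^ m" by (simp add: c_def)
    then have "(real m * c)\<^sup>2 \<le> (norm y ^ m)\<^sup>2" using c by (intro power_mono) auto
    then show ?thesis by (simp add: m power_mult)
  qed
  \<comment> \<open>Beyond this value of \<open>n\<close> the quadratic
    \<open>(n * c / 2)\<^sup>2\<close> exceeds \<open>n * (K + 1)\<close>. The exponent
    \<open>Suc k0\<close> makes \<open>n\<close> an even power of two, so that both
    \<open>pow\<close> and \<open>bern\<close> apply.\<close>
  obtain k0 where k0: "real k0 > 4 * (K + 1) / c\<^sup>2" using reals_Archimedean2 by blast
  define n where "n = (2::nat) ^ Suc k0"
  have n: "real n > 4 * (K + 1) / c\<^sup>2" "n \<ge> 1"
  proof -
    have "real k0 < real n"
      unfolding of_nat_less_iff n_def using less_exp[of "Suc k0"] by linarith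
    then show "real n > 4 * (K + 1) / c\<^sup>2" using k0 by linarith
  qed (simp add: n_def)
  have "(real n * c / 2)\<^sup>2 \<le> 1 + real n * C"
    using bern[of n] le[of n] pow[of "Suc k0"] by (simp add: n_def)
  also have "\<dots> \<le> real n * (K + 1)"
  proof -
    have "real n * C \<le> real n * K" by (intro mult_left_mono) (simp_all add: K_def)
    moreover have "1 \<le> real n" using n(2) by simp
    ultimately show ?thesis unfolding distrib_left by linarith
  qed
  finally have "real n * (c\<^sup>2 * real n) \<le> real n * (4 * (K + 1))"
    by (simp add: power2_eq_square field_simps)
  then have "c\<^sup>2 * real n \<le> 4 * (K + 1)" using n(2) by simp
  then show False using n(1) c by (simp add: field_simps)
qed

text \<open>Classically the two products have the same nonzero spectrum. Here \<open>(1 + e *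
  e\<^sup>\<star>) ^ n * e = e * (1 + e\<^sup>\<star> * e) ^ n\<close> does the transfer: as
  \<open>1 + e\<^sup>\<star> * e\<close> is a contraction, each further power of
  \<open>1 + e * e\<^sup>\<star>\<close> adds at most \<open>(norm e)\<^sup>2\<close> to the norm,
  and linear growth forces norm at most 1.\<close>

lemma spec_nonneg_minus_swap:
  fixes d :: "'a::cstar_algebra_1"
  assumes "spec_nonneg (- (d\<^sup>\<star> * d))" shows "spec_nonneg (- (d * d\<^sup>\<star>))"
proof -
  \<comment> \<open>Chosen so that \<open>e\<^sup>\<star> * e\<close> has norm at most 1 and the
    witness in \<open>spec_nonneg_norm_le\<close> can be 1; the summand 1 also covers
    \<open>d = 0\<close>.\<close>
  define t where "t = (norm d)\<^sup>2 + 1"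
  have t: "t > 0" by (simp add: t_def add_nonneg_pos)
  define e where "e = (1 / sqrt t) *\<^sub>R d"
  have ee: "e\<^sup>\<star> * e = (1/t) *\<^sub>R (d\<^sup>\<star> * d)" "e * e\<^sup>\<star> = (1/t) *\<^sub>R (d * d\<^sup>\<star>)"
    using t by (simp_all add: e_def cstar_scaleR)
  have "norm (- (e\<^sup>\<star> * e)) \<le> 1"
    using t by (simp add: ee(1) norm_cstar_mult) (simp add: t_def)
  moreover have "spec_nonneg (- (e\<^sup>\<star> * e))"
    using spec_nonneg_scaleR[OF assms, of "1/t"] t by (simp add: ee)
  ultimately have le: "norm (1 + e\<^sup>\<star> * e) \<le> 1"
    using spec_nonneg_norm_le[of "- (e\<^sup>\<star> * e)" 1] by simp
  have inter: "(1 + e * e\<^sup>\<star>) ^ n * (e * e\<^sup>\<star>) = e * (1 + e\<^sup>\<star> * e) ^ n * e\<^sup>\<star>" for n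
  proof -
    have "(1 + e * e\<^sup>\<star>) ^ n * e = e * (1 + e\<^sup>\<star> * e) ^ n"
    proof (induction n)
      case (Suc n)
      have "(1 + e * e\<^sup>\<star>) * e = e * (1 + e\<^sup>\<star> * e)" by (simp add: algebra_simps)
      then show ?case
        unfolding power_Suc2 by (metis Suc mult.assoc)
    qed simp
    then show ?thesis by (simp add: mult.assoc[symmetric])
  qed
  have growth: "norm ((1 + e * e\<^sup>\<star>) ^ n) \<le> 1 + real n * (norm e)\<^sup>2" for n
  proof (induction n)
    case (Suc n)
    have "norm ((1 + e\<^sup>\<star> * e) ^ n) \<le> 1"
      using norm_power_ineq[of "1 + e\<^sup>\<star> * e" n] le by (meson norm_ge_zero order_trans power_le_one)
    then have "norm (e * (1 + e\<^sup>\<star> * e) ^ n) \<le> norm e"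
      using norm_mult_ineq[of e "(1 + e\<^sup>\<star> * e) ^ n"]
      by (meson mult_left_le norm_ge_zero order_trans)
    then have "norm (e * (1 + e\<^sup>\<star> * e) ^ n * e\<^sup>\<star>) \<le> norm e * norm (e\<^sup>\<star>)"
      by (meson mult_right_mono norm_ge_zero norm_mult_ineq order_trans)
    moreover have "(1 + e * e\<^sup>\<star>) ^ Suc n = (1 + e * e\<^sup>\<star>) ^ n + e * (1 + e\<^sup>\<star> * e) ^ n * e\<^sup>\<star>"
      by (simp add: distrib_left power_Suc2 inter del: power_Suc)
    ultimately have "norm ((1 + e * e\<^sup>\<star>) ^ Suc n) \<le> norm ((1 + e * e\<^sup>\<star>) ^ n) + (norm e)\<^sup>2"
      using norm_triangle_ineq[of "(1 + e * e\<^sup>\<star>) ^ n" "e * (1 + e\<^sup>\<star> * e) ^ n * e\<^sup>\<star>"]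
      by (simp add: power2_eq_square)
    then show ?case using Suc by (simp add: algebra_simps)
  qed simp
  have "norm (1 + e * e\<^sup>\<star>) \<le> 1"
    by (rule selfadjoint_norm_le_1_of_growth[OF _ growth]) (simp add: cstar_add cstar_mult cstar_cstar)
  then have "spec_nonneg (- (e * e\<^sup>\<star>))"
    by (auto simp: spec_nonneg_def cstar_minus cstar_mult cstar_cstar intro!: exI[of _ 1])
  then have "spec_nonneg (t *\<^sub>R (- (e * e\<^sup>\<star>)))" by (rule spec_nonneg_scaleR) (use t in simp)
  then show ?thesis using t by (simp add: ee)
qed

text \<open>Up to sign, \<open>x\<close> and \<open>y\<close> are twice the real and the imaginary
  part of \<open>d\<close>; in the sum of their squares \<open>d * d\<close> and its adjoint
  cancel.\<close>

lemma spec_nonneg_cstar_mult_add: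
  fixes d :: "'a::cstar_algebra_1"
  shows "spec_nonneg (d\<^sup>\<star> * d + d * d\<^sup>\<star>)"
proof -
  define x where "x = d + d\<^sup>\<star>"
  define y where "y = \<i> *c (d - d\<^sup>\<star>)"
  have x: "x\<^sup>\<star> = x" by (simp add: x_def cstar_add cstar_cstar add.commute)
  have y: "y\<^sup>\<star> = y"
  proof -
    have "y\<^sup>\<star> = - (\<i> *c (d\<^sup>\<star> - d))"
      by (simp add: y_def cstar_scaleC cstar_diff cstar_cstar complex_vector.scale_minus_left)
    also have "\<dots> = y" by (simp add: y_def complex_vector.scale_right_diff_distrib)
    finally show ?thesis .
  qed
  have "y * y = - ((d - d\<^sup>\<star>) * (d - d\<^sup>\<star>))"
    by (simp add: y_def scaleC_mult_left scaleC_mult_right scaleC_scaleC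
        complex_vector.scale_minus_left scaleC_one)
  then have "x * x + y * y = 2 *\<^sub>R (d\<^sup>\<star> * d + d * d\<^sup>\<star>)"
    by (simp add: x_def algebra_simps scaleR_2)
  then have "d\<^sup>\<star> * d + d * d\<^sup>\<star> = (1/2) *\<^sub>R (x * x + y * y)" by simp
  also have "spec_nonneg \<dots>"
    by (intro spec_nonneg_scaleR spec_nonneg_add spec_nonneg_square x y) simp
  finally show ?thesis .
qed

text \<open>With \<open>g\<close> the negative part of \<open>b = c\<^sup>\<star> c\<close>, the element \<open>d = c g\<close> satisfies \<open>d\<^sup>\<star> d = - g\<^sup>3\<close>;
  then also \<open>- d d\<^sup>\<star>\<close> is positive, which forces \<open>d = 0\<close>.\<close>

lemma spec_nonneg_cstar_mult:
  fixes c :: "'a::cstar_algebra_1"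
  shows "spec_nonneg (c\<^sup>\<star> * c)"
proof -
  define b where "b = c\<^sup>\<star> * c"
  have b: "b\<^sup>\<star> = b" by (simp add: b_def cstar_mult cstar_cstar)
  \<comment> \<open>Here \<open>h\<close> is the absolute value of \<open>b\<close>. Its root
    \<open>k\<close> serves to write \<open>g * h * g\<close> as the square of the self-adjoint
    \<open>g * k\<close>.\<close>
  obtain h where h: "h\<^sup>\<star> = h" "h * h = b * b" "spec_nonneg h" "\<And>y. y * (b * b) = (b * b) * y \<Longrightarrow> y * h = h * y"
    using spec_nonneg_sqrt[OF spec_nonneg_square[OF b]] by blast
  obtain k where k: "k\<^sup>\<star> = k" "k * k = h" "\<And>y. y * h = h * y \<Longrightarrow> y * k = k * y"
    using spec_nonneg_sqrt[OF h(3)] by blast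
  have bh: "b * h = h * b" by (rule h(4)) (simp add: mult.assoc)
  define g where "g = h - b"
  have g: "g\<^sup>\<star> = g" by (simp add: g_def cstar_diff h(1) b)
  have gh: "g * h = h * g" by (simp add: g_def bh algebra_simps)
  have gk: "g * k = k * g" by (rule k(3)) (rule gh)
  \<comment> \<open>All three identities say \<open>(h - b) * (h + b) = 0\<close>, which holds since
    \<open>h\<close> and \<open>b\<close> commute and have the same square.\<close>
  have gb: "2 *\<^sub>R (g * b) = - (g * g)" by (simp add: g_def h(2) bh scaleR_2 algebra_simps)
  have gg: "g * g = 2 *\<^sub>R (g * h)" by (simp add: g_def h(2) bh scaleR_2 algebra_simps)
  have gbh: "g * b = - (g * h)" by (rule scaleR_left_imp_eq[of 2]) (use gb gg in simp_all)
  define d where "d = c * g"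
  have dd: "d\<^sup>\<star> * d = - ((g * k) * (g * k))"
  proof -
    have "d\<^sup>\<star> * d = g * b * g" by (simp add: d_def b_def cstar_mult g mult.assoc)
    also have "\<dots> = - (g * h * g)" by (simp add: gbh)
    also have "g * h * g = (g * k) * (g * k)"
      by (simp only: mult.assoc k(2)[symmetric]) (simp only: gk)
    finally show ?thesis .
  qed
  have "spec_nonneg ((g * k) * (g * k))"
    by (rule spec_nonneg_square) (simp add: cstar_mult g k(1) gk)
  then have neg: "spec_nonneg (- (d\<^sup>\<star> * d))" by (simp add: dd)
  \<comment> \<open>The sum leaves \<open>d\<^sup>\<star> * d\<close>, so this element and its
    negative are both positive; monotonicity of the norm against 0 then kills it.\<close>
  have "spec_nonneg ((d\<^sup>\<star> * d + d * d\<^sup>\<star>) + - (d * d\<^sup>\<star>))"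
    by (intro spec_nonneg_add spec_nonneg_cstar_mult_add spec_nonneg_minus_swap neg)
  then have "spec_nonneg (0 - (- (d\<^sup>\<star> * d)))" by simp
  from spec_nonneg_norm_mono[OF neg this] have "d = 0" by simp
  \<comment> \<open>The cube of \<open>g\<close> is a multiple of \<open>d\<^sup>\<star> * d\<close>
    and vanishes; so does the fourth power, and two uses of the norm identity give
    \<open>g = 0\<close>.\<close>
  have "g * g * g = 2 *\<^sub>R (g * h * g)" by (simp add: gg)
  also have "g * h * g = - (g * b * g)" by (simp add: gbh)
  also have "g * b * g = d\<^sup>\<star> * d" by (simp add: d_def b_def cstar_mult g mult.assoc)
  finally have "(g * g)\<^sup>\<star> * (g * g) = 0" using \<open>d = 0\<close> by (simp add: cstar_mult g mult.assoc[symmetric])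
  then have "g * g = 0" by (simp only: cstar_mult_self_eq_0_iff)
  then have "g = 0" using cstar_mult_self_eq_0_iff[of g] by (simp add: g)
  then have "b = h" by (simp add: g_def)
  then show ?thesis using h(3) by (simp add: b_def)
qed

lemma spec_nonneg_iff: "spec_nonneg a \<longleftrightarrow> 0 \<preceq> a"
proof
  assume "spec_nonneg a"
  then obtain w where "w\<^sup>\<star> = w" "w * w = a" by (rule spec_nonneg_sqrt)
  then show "0 \<preceq> a" by (auto simp: cstar_le_def intro!: exI[of _ w])
qed (auto simp: cstar_le_def spec_nonneg_cstar_mult)

section \<open>Unitization\<close>

text \<open>A separate datatype, because pairs already carry the Euclidean product norm, which is
  not the norm wanted here.\<close>

datatype 'a unitization = Unitization (scal: complex) (part: 'a)

lemma unitization_eqI: "scal u = scal v \<Longrightarrow> part u = part v \<Longrightarrow> u = v"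
  by (cases u; cases v) simp

instantiation unitization :: (cstar_algebra) "{ring_1, complex_vector, real_vector}"
begin

definition "0 = Unitization 0 0"
definition "1 = Unitization 1 0"
definition "u + v = Unitization (scal u + scal v) (part u + part v)"
definition "u - v = Unitization (scal u - scal v) (part u - part v)"
definition "- u = Unitization (- scal u) (- part u)"
definition "u * v = Unitization (scal u * scal v)
  (scal u *c part v + scal v *c part u + part u * part v)"
definition "c *c u = Unitization (c * scal u) (c *c part u)"
definition "r *\<^sub>R u = Unitization (r *\<^sub>R scal u) (r *\<^sub>R part u)"

lemmas unitization_ops = zero_unitization_def one_unitization_def plus_unitization_def
  minus_unitization_def uminus_unitization_def times_unitization_def scaleC_unitization_def
  scaleR_unitization_def

instance
  by standard
    (auto intro!: unitization_eqI simp: unitization_ops algebra_simps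
      scaleC_add_left scaleC_add_right scaleC_scaleC scaleC_one scaleC_mult_left scaleC_mult_right)

end

lemma scal_simps [simp]:
  "scal (0::'a unitization) = 0" "scal (1::'a unitization) = 1"
  "scal (u + v) = scal u + scal v" "scal (u - v) = scal u - scal v" "scal (- u) = - scal u"
  "scal (u * v) = scal u * scal v" "scal (c *c u) = c * scal u" "scal (r *\<^sub>R u) = r *\<^sub>R scal u"
  for u v :: "'a::cstar_algebra unitization"
  by (simp_all add: unitization_ops)

lemma part_simps [simp]:
  "part (0::'a unitization) = 0" "part (1::'a unitization) = 0"
  "part (u + v) = part u + part v" "part (u - v) = part u - part v" "part (- u) = - part u"
  "part (u * v) = scal u *c part v + scal v *c part u + part u * part v"
  "part (c *c u) = c *c part u" "part (r *\<^sub>R u) = r *\<^sub>R part u"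
  for u v :: "'a::cstar_algebra unitization"
  by (simp_all add: unitization_ops)

lemma scaleR_scaleC: "(r *\<^sub>R c) *c x = r *\<^sub>R (c *c x)" for x :: "'a::cstar_algebra"
  by (simp add: scaleR_conv_of_real scaleC_scaleC flip: scaleC_of_real)

lemma scaleC_scaleR: "c *c (r *\<^sub>R x) = r *\<^sub>R (c *c x)" for x :: "'a::cstar_algebra"
  by (simp add: scaleC_scaleC mult.commute[of c] flip: scaleC_of_real)

text \<open>Left multiplication on the ideal \<open>'a\<close> of the unitization.\<close>

definition unitization_act :: "'a::cstar_algebra unitization \<Rightarrow> 'a \<Rightarrow> 'a" where
  "unitization_act u x = scal u *c x + part u * x"

lemma bounded_linear_scaleC: "bounded_linear (\<lambda>x::'a::cstar_algebra. c *c x)"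
  by (rule bounded_linear_intro[where K = "cmod c"])
    (simp_all add: scaleC_add_right norm_scaleC mult.commute scaleC_scaleC flip: scaleC_of_real)

lemma bounded_linear_unitization_act: "bounded_linear (unitization_act u)"
  unfolding unitization_act_def
  by (intro bounded_linear_add bounded_linear_scaleC bounded_linear_mult_right)

lemma unitization_act_mult: "unitization_act (u * v) x = unitization_act u (unitization_act v x)"
  by (simp add: unitization_act_def algebra_simps scaleC_add_left scaleC_add_right scaleC_scaleC
      scaleC_mult_left scaleC_mult_right)

lemma unitization_act_linear:
  "unitization_act (u + v) x = unitization_act u x + unitization_act v x"
  "unitization_act (r *\<^sub>R u) x = r *\<^sub>R unitization_act u x"
  by (simp_all add: unitization_act_def scaleC_add_left scaleR_scaleC distrib_right
      scaleR_right_distrib)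

lemma norm_unitization_act_le: "norm (unitization_act u x) \<le> onorm (unitization_act u) * norm x"
  by (rule onorm[OF bounded_linear_unitization_act])

text \<open>If \<open>'a\<close> has a unit, the operator norm alone does not separate the points of
  \<open>\<complex> \<oplus> 'a\<close>; the maximum with the modulus of the scalar part is still a \<open>C\<^sup>*\<close>-norm.\<close>

instantiation unitization :: (cstar_algebra) real_normed_algebra_1
begin

definition "norm u = max (cmod (scal u)) (onorm (unitization_act u))"
definition "dist u v = norm (u - v)" for u v :: "'a unitization"
definition "sgn u = u /\<^sub>R norm u" for u :: "'a unitization"
definition "(uniformity :: ('a unitization \<times> 'a unitization) filter) =
  (INF e\<in>{0<..}. principal {(x, y). dist x y < e})"
definition "open U \<longleftrightarrow> (\<forall>x\<in>U. \<forall>\<^sub>F (x', y) in uniformity. x' = x \<longrightarrow> y \<in> U)"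
  for U :: "'a unitization set"

instance
proof
  fix u v :: "'a unitization" and r :: real
  show "r *\<^sub>R u * v = r *\<^sub>R (u * v)" "u * r *\<^sub>R v = r *\<^sub>R (u * v)"
    by (auto intro!: unitization_eqI
        simp: scaleR_scaleC scaleC_scaleR scaleR_right_distrib)
  show "norm u = 0 \<longleftrightarrow> u = 0"
  proof
    assume u: "norm u = 0"
    then have s: "scal u = 0"
      using norm_ge_zero[of "scal u"] by (simp add: norm_unitization_def max_def split: if_splits)
    have "onorm (unitization_act u) \<le> 0" using u by (simp add: norm_unitization_def max_def split: if_splits)
    then have "onorm (unitization_act u) = 0"
      using onorm_pos_le[OF bounded_linear_unitization_act] by (rule antisym)
    then have "unitization_act u ((part u)\<^sup>\<star>) = 0"
      using norm_unitization_act_le[of u "(part u)\<^sup>\<star>"] by simp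
    then have "part u * (part u)\<^sup>\<star> = 0" by (simp add: unitization_act_def s)
    then have "part u = 0" using cstar_mult_self_eq_0_iff[of "(part u)\<^sup>\<star>"]
      by (metis cstar_cstar cstar_zero)
    then show "u = 0" using s by (auto intro!: unitization_eqI)
  next
    assume "u = 0"
    then have "unitization_act u = (\<lambda>x. 0)" by (simp add: unitization_act_def fun_eq_iff)
    then show "norm u = 0" using \<open>u = 0\<close> by (simp add: norm_unitization_def onorm_zero)
  qed
  have "onorm (unitization_act (u + v)) \<le> onorm (unitization_act u) + onorm (unitization_act v)"
    using onorm_triangle[OF bounded_linear_unitization_act bounded_linear_unitization_act, of u v]
    unfolding unitization_act_linear[symmetric] .
  then show "norm (u + v) \<le> norm u + norm v"
    using norm_triangle_ineq[of "scal u" "scal v"] by (simp add: norm_unitization_def max_def)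
  have "onorm (unitization_act (r *\<^sub>R u)) = \<bar>r\<bar> * onorm (unitization_act u)"
    using onorm_scaleR[OF bounded_linear_unitization_act, of r u]
    unfolding unitization_act_linear[symmetric] .
  then show "norm (r *\<^sub>R u) = \<bar>r\<bar> * norm u"
    by (simp add: norm_unitization_def max_mult_distrib_left)
  have "unitization_act (u * v) = unitization_act u \<circ> unitization_act v"
    by (simp add: fun_eq_iff unitization_act_mult)
  then have "onorm (unitization_act (u * v)) \<le> onorm (unitization_act u) * onorm (unitization_act v)"
    using onorm_compose[OF bounded_linear_unitization_act bounded_linear_unitization_act, of u v] by simp
  also have "\<dots> \<le> norm u * norm v"
    by (intro mult_mono) (auto simp: norm_unitization_def onorm_pos_le bounded_linear_unitization_act le_max_iff_disj)
  finally have "onorm (unitization_act (u * v)) \<le> norm u * norm v" .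
  moreover have "cmod (scal u * scal v) \<le> norm u * norm v"
    unfolding norm_mult by (intro mult_mono) (auto simp: norm_unitization_def le_max_iff_disj)
  ultimately show "norm (u * v) \<le> norm u * norm v"
    by (simp add: norm_unitization_def[of "u * v"])
  have "unitization_act (1::'a unitization) = (\<lambda>x. x)" by (simp add: unitization_act_def fun_eq_iff scaleC_one)
  then show "norm (1::'a unitization) = 1"
    using onorm_id_le[where 'a = 'a] by (simp add: norm_unitization_def max_def)
qed (simp_all only: dist_unitization_def sgn_unitization_def uniformity_unitization_def open_unitization_def)

end

lemma norm_scal_le: "cmod (scal u) \<le> norm u"
  and onorm_act_le: "onorm (unitization_act u) \<le> norm u"
  for u :: "'a::cstar_algebra unitization"
  by (simp_all add: norm_unitization_def)

text \<open>Acting on the adjoint \<open>x\<close> of \<open>part u\<close> loses nothing, since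
  \<open>norm (part u * x) = norm (part u) * norm x\<close>; removing the scalar term costs the
  factor 2. Completeness of the unitization follows componentwise.\<close>

lemma norm_part_le: "norm (part u) \<le> 2 * norm u"
  for u :: "'a::cstar_algebra unitization"
proof (cases "part u = 0")
  case False
  define x where "x = (part u)\<^sup>\<star>"
  have "norm (part u * x) = norm (unitization_act u x - scal u *c x)"
    by (simp add: unitization_act_def)
  also have "\<dots> \<le> norm (unitization_act u x) + cmod (scal u) * norm x"
    using norm_triangle_ineq4 by (metis norm_scaleC)
  also have "\<dots> \<le> norm u * norm x + norm u * norm x"
    by (intro add_mono mult_right_mono norm_scal_le order_trans[OF norm_unitization_act_le] onorm_act_le)
      simp_all
  finally have "norm (part u * x) \<le> 2 * norm u * norm x" by (simp add: mult_ac)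
  moreover have "norm (part u * x) = norm (part u) * norm x"
    using norm_cstar_mult[of x] by (simp add: x_def cstar_cstar power2_eq_square)
  ultimately show ?thesis using False by (simp add: x_def)
qed simp

lemma norm_unitization_le: "norm u \<le> cmod (scal u) + norm (part u)"
  for u :: "'a::cstar_algebra unitization"
proof -
  have "onorm (unitization_act u) \<le> cmod (scal u) + norm (part u)"
  proof (rule onorm_bound)
    fix x
    show "norm (unitization_act u x) \<le> (cmod (scal u) + norm (part u)) * norm x"
      unfolding unitization_act_def distrib_right norm_scaleC[symmetric]
      by (intro norm_triangle_le add_left_mono norm_mult_ineq)
  qed simp
  then show ?thesis by (simp add: norm_unitization_def)
qed

instantiation unitization :: (cstar_algebra) cstar_algebra_1
begin

definition "u\<^sup>\<star> = Unitization (cnj (scal u)) ((part u)\<^sup>\<star>)"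

lemma cstar_unitization_simps [simp]:
  "scal (u\<^sup>\<star>) = cnj (scal u)" "part (u\<^sup>\<star>) = (part u)\<^sup>\<star>" for u :: "'a unitization"
  by (simp_all add: cstar_unitization_def)

instance
proof
  fix X :: "nat \<Rightarrow> 'a unitization" assume X: "Cauchy X"
  have "Cauchy (\<lambda>n. scal (X n))"
  proof (rule CauchyI)
    fix e :: real assume "e > 0"
    then show "\<exists>M. \<forall>m\<ge>M. \<forall>n\<ge>M. norm (scal (X m) - scal (X n)) < e"
      using CauchyD[OF X] norm_scal_le by (metis order_le_less_trans scal_simps(4))
  qed
  then obtain s where s: "(\<lambda>n. scal (X n)) \<longlonglongrightarrow> s"
    using Cauchy_convergent convergent_def by blast
  have "Cauchy (\<lambda>n. part (X n))"
  proof (rule CauchyI)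
    fix e :: real assume "e > 0"
    then obtain M where "\<forall>m\<ge>M. \<forall>n\<ge>M. norm (X m - X n) < e / 2"
      using CauchyD[OF X, of "e / 2"] by auto
    moreover have "norm (part (X m) - part (X n)) \<le> 2 * norm (X m - X n)" for m n
      using norm_part_le[of "X m - X n"] by simp
    ultimately show "\<exists>M. \<forall>m\<ge>M. \<forall>n\<ge>M. norm (part (X m) - part (X n)) < e"
      by (intro exI[of _ M]) (smt (verit) field_sum_of_halves)
  qed
  then obtain p where p: "(\<lambda>n. part (X n)) \<longlonglongrightarrow> p"
    using Cauchy_convergent convergent_def by blast
  have "X \<longlonglongrightarrow> Unitization s p"
  proof (rule Lim_null_comparison[THEN Lim_null[THEN iffD2]])
    show "\<forall>\<^sub>F n in sequentially. norm (X n - Unitization s p)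
      \<le> cmod (scal (X n) - s) + norm (part (X n) - p)"
      using norm_unitization_le[of "X _ - Unitization s p"] by simp
    show "(\<lambda>n. cmod (scal (X n) - s) + norm (part (X n) - p)) \<longlonglongrightarrow> 0"
      using tendsto_add[OF tendsto_norm_zero[OF LIM_zero[OF s]] tendsto_norm_zero[OF LIM_zero[OF p]]]
      by simp
  qed
  then show "convergent X" by (rule convergentI)
next
  fix u v :: "'a unitization" and r :: real and c :: complex
  show "complex_of_real r *c u = r *\<^sub>R u"
    by (auto intro!: unitization_eqI simp: scaleC_of_real scaleR_conv_of_real[where 'a = complex])
  show "(c *c u) * v = c *c (u * v)" "u * (c *c v) = c *c (u * v)"
    by (auto intro!: unitization_eqI simp: scaleC_mult_left scaleC_mult_right scaleC_scaleC
        scaleC_add_right mult.commute[of c])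
  have act_c: "unitization_act (c *c u) x = c *c unitization_act u x" for x
    by (simp add: unitization_act_def scaleC_add_right scaleC_scaleC scaleC_mult_left)
  have "onorm (unitization_act (c *c u)) = cmod c * onorm (unitization_act u)"
  proof (rule antisym)
    show "onorm (unitization_act (c *c u)) \<le> cmod c * onorm (unitization_act u)"
      by (rule onorm_bound) (auto simp: act_c norm_scaleC mult.assoc onorm_pos_le
          bounded_linear_unitization_act intro!: mult_left_mono norm_unitization_act_le)
    show "cmod c * onorm (unitization_act u) \<le> onorm (unitization_act (c *c u))"
    proof (cases "c = 0")
      case False
      have "onorm (unitization_act u) \<le> onorm (unitization_act (c *c u)) / cmod c"
      proof (rule onorm_bound)
        fix x
        have "cmod c * norm (unitization_act u x) \<le> onorm (unitization_act (c *c u)) * norm x"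
          using norm_unitization_act_le[of "c *c u" x] by (simp add: act_c norm_scaleC)
        then show "norm (unitization_act u x) \<le> onorm (unitization_act (c *c u)) / cmod c * norm x"
          using False by (simp add: field_simps)
      qed (simp add: onorm_pos_le bounded_linear_unitization_act)
      then show ?thesis using False by (simp add: field_simps)
    qed (simp add: onorm_pos_le bounded_linear_unitization_act)
  qed
  then show "norm (c *c u) = cmod c * norm u"
    by (simp add: norm_unitization_def norm_mult max_mult_distrib_left)
  show "(u + v)\<^sup>\<star> = u\<^sup>\<star> + v\<^sup>\<star>" "(c *c u)\<^sup>\<star> = cnj c *c u\<^sup>\<star>" "(u\<^sup>\<star>)\<^sup>\<star> = u"
    by (auto intro!: unitization_eqI simp: cstar_add cstar_scaleC cstar_cstar)
  show "(u * v)\<^sup>\<star> = v\<^sup>\<star> * u\<^sup>\<star>"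
    by (auto intro!: unitization_eqI simp: cstar_add cstar_scaleC cstar_mult add.commute)
  \<comment> \<open>With \<open>x\<^sup>\<star> * y\<close> as an algebra-valued inner product, the
    actions of \<open>w\<close> and \<open>w\<^sup>\<star>\<close> are adjoint, and the Hilbert
    space proof of the norm identity carries over.\<close>
  have inner: "(unitization_act w x)\<^sup>\<star> * y = x\<^sup>\<star> * unitization_act (w\<^sup>\<star>) y"
    for w :: "'a unitization" and x y
    by (simp add: unitization_act_def cstar_add cstar_scaleC cstar_mult distrib_left distrib_right
        scaleC_mult_left scaleC_mult_right mult.assoc)
  have cstar_act: "(w\<^sup>\<star>)\<^sup>\<star> = w" for w :: "'a unitization"
    by (auto intro!: unitization_eqI simp: cstar_cstar)
  have sq: "(onorm (unitization_act w))\<^sup>2 \<le> onorm (unitization_act (w\<^sup>\<star> * w))" for w :: "'a unitization"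
  proof -
    let ?K = "onorm (unitization_act (w\<^sup>\<star> * w))"
    have K: "0 \<le> ?K" by (rule onorm_pos_le[OF bounded_linear_unitization_act])
    have "onorm (unitization_act w) \<le> sqrt ?K"
    proof (rule onorm_bound)
      fix x
      have "(norm (unitization_act w x))\<^sup>2 = norm (x\<^sup>\<star> * unitization_act (w\<^sup>\<star> * w) x)"
        by (simp add: inner unitization_act_mult flip: norm_cstar_mult)
      also have "\<dots> \<le> norm x * (?K * norm x)"
        by (rule order_trans[OF norm_mult_ineq]) (simp add: mult_left_mono norm_unitization_act_le)
      also have "\<dots> = (sqrt ?K * norm x)\<^sup>2"
        using K by (simp add: power_mult_distrib) (simp add: power2_eq_square)
      finally show "norm (unitization_act w x) \<le> sqrt ?K * norm x"
        by (rule power2_le_imp_le) (simp add: K)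
    qed (simp add: K)
    then have "(onorm (unitization_act w))\<^sup>2 \<le> (sqrt ?K)\<^sup>2"
      by (intro power_mono onorm_pos_le bounded_linear_unitization_act)
    then show ?thesis using K by simp
  qed
  have comp: "onorm (unitization_act (w * z)) \<le> onorm (unitization_act w) * onorm (unitization_act z)"
    for w z :: "'a unitization"
    using onorm_compose[OF bounded_linear_unitization_act bounded_linear_unitization_act, of w z]
    by (simp add: comp_def flip: unitization_act_mult)
  have star_le: "onorm (unitization_act w) \<le> onorm (unitization_act (w\<^sup>\<star>))" for w :: "'a unitization"
  proof (cases "onorm (unitization_act w) = 0")
    case True then show ?thesis by (simp add: onorm_pos_le bounded_linear_unitization_act)
  next
    case False
    then have "0 < onorm (unitization_act w)"
      using onorm_pos_le[OF bounded_linear_unitization_act, of w] by simp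
    moreover have "(onorm (unitization_act w))\<^sup>2 \<le> onorm (unitization_act (w\<^sup>\<star>)) * onorm (unitization_act w)"
      by (rule order_trans[OF sq comp])
    ultimately show ?thesis by (simp add: power2_eq_square)
  qed
  have "onorm (unitization_act (u\<^sup>\<star>)) = onorm (unitization_act u)"
    using star_le[of u] star_le[of "u\<^sup>\<star>"] by (simp add: cstar_act)
  then have "onorm (unitization_act (u\<^sup>\<star> * u)) = (onorm (unitization_act u))\<^sup>2"
    using sq[of u] comp[of "u\<^sup>\<star>" u] by (simp add: power2_eq_square)
  moreover have "max (a\<^sup>2) (b\<^sup>2) = (max a b)\<^sup>2" if "a \<ge> 0" "b \<ge> 0" for a b :: real
    using that by (auto simp: max_def)
  ultimately show "norm (u\<^sup>\<star> * u) = (norm u)\<^sup>2"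
    by (simp add: norm_unitization_def norm_mult onorm_pos_le bounded_linear_unitization_act
        power2_eq_square[of "cmod _", symmetric])
qed

end

definition unitize :: "'a::cstar_algebra \<Rightarrow> 'a unitization" where
  "unitize a = Unitization 0 a"

lemma unitize_simps:
  "unitize (a + b) = unitize a + unitize b" "unitize (a - b) = unitize a - unitize b"
  "unitize (a * b) = unitize a * unitize b" "unitize (a\<^sup>\<star>) = (unitize a)\<^sup>\<star>"
  "unitize (r *\<^sub>R a) = r *\<^sub>R unitize a" "unitize 0 = 0"
  by (auto simp: unitize_def intro!: unitization_eqI)

lemma norm_unitize [simp]: "norm (unitize a) = norm a"
proof (rule antisym)
  show "norm (unitize a) \<le> norm a"
    using norm_unitization_le[of "unitize a"] by (simp add: unitize_def)
  show "norm a \<le> norm (unitize a)"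
  proof (cases "a = 0")
    case False
    have "norm a * norm a = norm (unitization_act (unitize a) (a\<^sup>\<star>))"
      using norm_cstar_mult[of "a\<^sup>\<star>"]
      by (simp add: unitization_act_def unitize_def cstar_cstar power2_eq_square)
    also have "\<dots> \<le> norm (unitize a) * norm a"
      using norm_unitization_act_le[of "unitize a" "a\<^sup>\<star>"]
        mult_right_mono[OF onorm_act_le[of "unitize a"] norm_ge_zero[of a]] by simp
    finally show ?thesis using False by simp
  qed simp
qed

lemma unitize_part: "scal u = 0 \<Longrightarrow> unitize (part u) = u"
  by (cases u) (simp add: unitize_def)

lemma scal_unitize [simp]: "scal (unitize a) = 0"
  by (simp add: unitize_def)

lemma inj_unitize: "unitize a = unitize b \<Longrightarrow> a = b"
  by (simp add: unitize_def)

text \<open>The scalar part of \<open>u\<^sup>\<star> * u\<close> is the squared modulus of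
  \<open>scal u\<close>, so a root found in the unitization lies in \<open>'a\<close>. Through this,
  positivity returns to the algebra without unit.\<close>

lemma unitize_square_root:
  assumes "unitize a = u\<^sup>\<star> * u" shows "0 \<preceq> a"
proof -
  have "cnj (scal u) * scal u = 0" using arg_cong[OF assms, of scal] by simp
  then have "unitize (part u) = u" by (simp add: unitize_part)
  then have "unitize a = unitize ((part u)\<^sup>\<star> * part u)" by (simp add: unitize_simps assms)
  then show ?thesis by (auto simp: cstar_le_def dest: inj_unitize)
qed

lemma cstar_pos_iff: "0 \<preceq> a \<longleftrightarrow> spec_nonneg (unitize a)"
proof
  assume "0 \<preceq> a"
  then obtain c where "a = c\<^sup>\<star> * c" by (auto simp: cstar_le_def)
  then show "spec_nonneg (unitize a)" by (simp add: unitize_simps spec_nonneg_cstar_mult)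
next
  assume "spec_nonneg (unitize a)"
  then show "0 \<preceq> a"
    unfolding spec_nonneg_iff by (auto simp: cstar_le_def[of _ "unitize a"] dest: unitize_square_root)
qed

section \<open>The order of a \<open>C\<^sup>*\<close>-algebra\<close>

lemma cstar_le_iff_diff: "a \<preceq> b \<longleftrightarrow> 0 \<preceq> b - a"
  by (simp add: cstar_le_def)

lemma cstar_square_nonneg [simp]: "0 \<preceq> c\<^sup>\<star> * c"
  by (auto simp: cstar_le_def)

lemma cstar_nonneg_0 [simp]: "0 \<preceq> (0::'a::cstar_algebra)"
  using cstar_square_nonneg[of "0::'a"] by simp

lemma cstar_nonneg_add: "0 \<preceq> a \<Longrightarrow> 0 \<preceq> b \<Longrightarrow> 0 \<preceq> a + b"
  by (simp add: cstar_pos_iff unitize_simps spec_nonneg_add)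

lemma cstar_nonneg_scaleR: "0 \<preceq> a \<Longrightarrow> r \<ge> 0 \<Longrightarrow> 0 \<preceq> r *\<^sub>R a"
  by (simp add: cstar_pos_iff unitize_simps spec_nonneg_scaleR)

lemma cstar_nonneg_sum: "(\<And>i. i \<in> I \<Longrightarrow> 0 \<preceq> f i) \<Longrightarrow> 0 \<preceq> sum f I"
  by (induction I rule: infinite_finite_induct) (auto intro: cstar_nonneg_add)

lemma cstar_le_refl [simp]: "a \<preceq> a"
  by (simp add: cstar_le_iff_diff[of a a])

lemma cstar_le_trans [trans]: "a \<preceq> b \<Longrightarrow> b \<preceq> c \<Longrightarrow> a \<preceq> c"
  unfolding cstar_le_iff_diff[of a b] cstar_le_iff_diff[of b c] cstar_le_iff_diff[of a c]
  by (drule (1) cstar_nonneg_add) simp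

lemma cstar_le_add_mono: "a \<preceq> b \<Longrightarrow> c \<preceq> d \<Longrightarrow> a + c \<preceq> b + d"
  unfolding cstar_le_iff_diff[of a b] cstar_le_iff_diff[of c d] cstar_le_iff_diff[of "a + c"]
  by (drule (1) cstar_nonneg_add) (simp add: algebra_simps)

lemma cstar_le_scaleR_mono: "a \<preceq> b \<Longrightarrow> r \<ge> 0 \<Longrightarrow> r *\<^sub>R a \<preceq> r *\<^sub>R b"
  unfolding cstar_le_iff_diff[of a b] cstar_le_iff_diff[of "r *\<^sub>R a"]
  by (drule (1) cstar_nonneg_scaleR) (simp add: scaleR_right_diff_distrib)

lemma cstar_le_scaleR_left: "0 \<preceq> a \<Longrightarrow> r \<le> s \<Longrightarrow> r *\<^sub>R a \<preceq> s *\<^sub>R a"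
  unfolding cstar_le_iff_diff[of "r *\<^sub>R a"]
  using cstar_nonneg_scaleR[of a "s - r"] by (simp add: scaleR_left_diff_distrib)

lemma cstar_nonneg_lim:
  fixes a :: "nat \<Rightarrow> 'a::cstar_algebra"
  assumes "\<And>n. 0 \<preceq> a n" "a \<longlonglongrightarrow> l" shows "0 \<preceq> l"
  unfolding cstar_pos_iff
proof (rule spec_nonneg_closed)
  show "spec_nonneg (unitize (a n))" for n using assms(1) by (simp add: cstar_pos_iff)
  show "(\<lambda>n. unitize (a n)) \<longlonglongrightarrow> unitize l"
    using assms(2) unfolding LIMSEQ_iff by (simp flip: unitize_simps)
qed

lemma cstar_le_lim:
  fixes a b :: "nat \<Rightarrow> 'a::cstar_algebra"
  assumes "\<And>n. a n \<preceq> b n" "a \<longlonglongrightarrow> k" "b \<longlonglongrightarrow> l" shows "k \<preceq> l"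
  unfolding cstar_le_iff_diff[of k]
  by (rule cstar_nonneg_lim[OF _ tendsto_diff[OF assms(3,2)]])
    (use assms(1) cstar_le_iff_diff in blast)

lemma cstar_norm_mono:
  assumes "0 \<preceq> a" "a \<preceq> b" shows "norm a \<le> norm b"
proof -
  have "spec_nonneg (unitize b - unitize a)"
    using assms(2) unfolding cstar_le_iff_diff[of a] by (simp add: cstar_pos_iff unitize_simps)
  then show ?thesis using spec_nonneg_norm_mono assms(1) by (fastforce simp: cstar_pos_iff)
qed

section \<open>Cauchy-Schwarz inequalities and a convexity estimate\<close>

text \<open>The root \<open>w\<close> of \<open>norm a *\<^sub>R 1 - a\<close> exists in the
  unitization only, but the difference of the two sides is
  \<open>(w * c)\<^sup>\<star> * (w * c)\<close> and \<open>unitize_square_root\<close>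
  applies.\<close>

lemma cstar_conj_le_norm:
  fixes a :: "'a::cstar_algebra"
  assumes "0 \<preceq> a" shows "c\<^sup>\<star> * a * c \<preceq> norm a *\<^sub>R (c\<^sup>\<star> * c)"
proof -
  let ?a = "unitize a" and ?c = "unitize c"
  have a: "?a\<^sup>\<star> = ?a" "spec_nonneg ?a"
    using assms by (simp_all add: cstar_pos_iff spec_nonneg_sa)
  have "norm (norm a *\<^sub>R 1 - (norm a *\<^sub>R 1 - ?a)) \<le> norm a" by simp
  then have "spec_nonneg (norm a *\<^sub>R 1 - ?a)"
    using norm_ge_zero[of a] unfolding spec_nonneg_def
    by (intro conjI exI[of _ "norm a"]) (simp_all add: cstar_diff cstar_scaleR a(1))
  then obtain w where w: "w\<^sup>\<star> = w" "w * w = norm a *\<^sub>R 1 - ?a" by (rule spec_nonneg_sqrt)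
  have "unitize (norm a *\<^sub>R (c\<^sup>\<star> * c) - c\<^sup>\<star> * a * c) = ?c\<^sup>\<star> * (norm a *\<^sub>R 1 - ?a) * ?c"
    by (simp add: unitize_simps algebra_simps)
  also have "\<dots> = (w * ?c)\<^sup>\<star> * (w * ?c)"
    by (simp add: cstar_mult w(1) mult.assoc flip: w(2))
  finally show ?thesis unfolding cstar_le_iff_diff[of "c\<^sup>\<star> * a * c"] by (rule unitize_square_root)
qed

text \<open>The hypothesis is the expansion of <x a - y, x a - y> with \<alpha> = <x, x>, \<beta> =
  <x, y>, \<gamma> = <y, y>. No module occurs, so that finite sums, Hilbert modules and semidefinite
  forms are all covered. For \<open>t > norm \<alpha>\<close>, the choice
  \<open>a = (1/t) *\<^sub>R \<beta>\<close> gives \<open>(1/t) *\<^sub>R (\<beta>\<^sup>\<star> *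
  \<beta>) \<preceq> \<gamma>\<close>.\<close>

lemma cstar_cauchy_schwarz:
  fixes \<alpha> \<beta> \<gamma> :: "'a::cstar_algebra"
  assumes \<alpha>: "0 \<preceq> \<alpha>" and pos: "\<And>a. 0 \<preceq> a\<^sup>\<star> * \<alpha> * a - a\<^sup>\<star> * \<beta> - \<beta>\<^sup>\<star> * a + \<gamma>"
  shows "(norm \<beta>)\<^sup>2 \<le> norm \<alpha> * norm \<gamma>"
proof -
  have le: "(norm \<beta>)\<^sup>2 \<le> t * norm \<gamma>" if t: "t > norm \<alpha>" for t
  proof -
    have tp: "t > 0" using t norm_ge_zero[of \<alpha>] by linarith
    define b where "b = (1/t) *\<^sub>R \<beta>"
    have "b\<^sup>\<star> * \<alpha> * b \<preceq> norm \<alpha> *\<^sub>R (b\<^sup>\<star> * b)" by (rule cstar_conj_le_norm[OF \<alpha>])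
    also have "\<dots> = (norm \<alpha> / t\<^sup>2) *\<^sub>R (\<beta>\<^sup>\<star> * \<beta>)"
      by (simp add: b_def cstar_scaleR power2_eq_square)
    also have "\<dots> \<preceq> (1/t) *\<^sub>R (\<beta>\<^sup>\<star> * \<beta>)"
      by (rule cstar_le_scaleR_left) (use t tp in \<open>simp_all add: power2_eq_square field_simps\<close>)
    finally have "b\<^sup>\<star> * \<alpha> * b \<preceq> (1/t) *\<^sub>R (\<beta>\<^sup>\<star> * \<beta>)" .
    then have "0 \<preceq> (1/t) *\<^sub>R (\<beta>\<^sup>\<star> * \<beta>) - b\<^sup>\<star> * \<alpha> * b"
      using cstar_le_iff_diff by blast
    from cstar_nonneg_add[OF this pos[of b]]
    have "0 \<preceq> \<gamma> - (1/t) *\<^sub>R (\<beta>\<^sup>\<star> * \<beta>)"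
      by (simp add: b_def cstar_scaleR)
    then have "(1/t) *\<^sub>R (\<beta>\<^sup>\<star> * \<beta>) \<preceq> \<gamma>" using cstar_le_iff_diff by blast
    moreover have "0 \<preceq> (1/t) *\<^sub>R (\<beta>\<^sup>\<star> * \<beta>)" by (rule cstar_nonneg_scaleR) (use tp in simp_all)
    ultimately have "norm ((1/t) *\<^sub>R (\<beta>\<^sup>\<star> * \<beta>)) \<le> norm \<gamma>" by (intro cstar_norm_mono)
    then show ?thesis using tp by (simp add: norm_cstar_mult field_simps)
  qed
  show ?thesis
  proof (rule field_le_epsilon)
    fix e :: real assume e: "e > 0"
    define d where "d = e / (norm \<gamma> + 1)"
    have g1: "norm \<gamma> + 1 > 0" using norm_ge_zero[of \<gamma>] by linarith
    have d: "d > 0" using e g1 by (simp add: d_def)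
    have "d * norm \<gamma> \<le> d * (norm \<gamma> + 1)" using d by (intro mult_left_mono) auto
    also have "\<dots> = e" using g1 by (simp add: d_def)
    finally show "(norm \<beta>)\<^sup>2 \<le> norm \<alpha> * norm \<gamma> + e"
      using le[of "norm \<alpha> + d"] d by (simp add: distrib_right)
  qed
qed

lemma cstar_sum_cauchy_schwarz:
  fixes p q :: "'i \<Rightarrow> 'a::cstar_algebra"
  shows "(norm (\<Sum>i\<in>F. (p i)\<^sup>\<star> * q i))\<^sup>2 \<le> norm (\<Sum>i\<in>F. (p i)\<^sup>\<star> * p i) * norm (\<Sum>i\<in>F. (q i)\<^sup>\<star> * q i)"
proof (rule cstar_cauchy_schwarz)
  fix a
  have "(\<Sum>i\<in>F. (p i * a - q i)\<^sup>\<star> * (p i * a - q i))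
     = a\<^sup>\<star> * (\<Sum>i\<in>F. (p i)\<^sup>\<star> * p i) * a - a\<^sup>\<star> * (\<Sum>i\<in>F. (p i)\<^sup>\<star> * q i)
       - (\<Sum>i\<in>F. (p i)\<^sup>\<star> * q i)\<^sup>\<star> * a + (\<Sum>i\<in>F. (q i)\<^sup>\<star> * q i)"
    by (simp add: cstar_sum cstar_mult cstar_cstar cstar_diff sum_distrib_left sum_distrib_right
        sum_subtractf sum.distrib algebra_simps)
  then show "0 \<preceq> a\<^sup>\<star> * (\<Sum>i\<in>F. (p i)\<^sup>\<star> * p i) * a - a\<^sup>\<star> * (\<Sum>i\<in>F. (p i)\<^sup>\<star> * q i)
       - (\<Sum>i\<in>F. (p i)\<^sup>\<star> * q i)\<^sup>\<star> * a + (\<Sum>i\<in>F. (q i)\<^sup>\<star> * q i)"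
    using cstar_nonneg_sum[of F "\<lambda>i. (p i * a - q i)\<^sup>\<star> * (p i * a - q i)"] by simp
qed (simp add: cstar_nonneg_sum)

text \<open>Midpoint convexity along 0, k, 2 k, iterated over powers of two, bounds
  \<open>f 1\<close> by a convex combination of \<open>f 0\<close> and \<open>f (2 ^ n)\<close>. The
  weight of the latter is \<open>(1/2) ^ n\<close>, which boundedness makes negligible.\<close>

lemma cstar_le_of_doubling:
  fixes f :: "nat \<Rightarrow> 'a::cstar_algebra"
  assumes double: "\<And>k. 2 *\<^sub>R f k \<preceq> f 0 + f (2 * k)" and bound: "\<And>k. norm (f k) \<le> M"
  shows "f 1 \<preceq> f 0"
proof -
  have le: "f 1 \<preceq> (1 - (1/2) ^ n) *\<^sub>R f 0 + (1/2) ^ n *\<^sub>R f (2 ^ n)" for n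
  proof (induction n)
    case (Suc n)
    have "((1/2) ^ Suc n) *\<^sub>R (2 *\<^sub>R f (2 ^ n)) \<preceq> ((1/2) ^ Suc n) *\<^sub>R (f 0 + f (2 * 2 ^ n))"
      by (rule cstar_le_scaleR_mono[OF double]) simp
    then have "(1/2) ^ n *\<^sub>R f (2 ^ n) \<preceq> ((1/2) ^ Suc n) *\<^sub>R (f 0 + f (2 ^ Suc n))" by simp
    then have "(1 - (1/2) ^ n) *\<^sub>R f 0 + (1/2) ^ n *\<^sub>R f (2 ^ n)
       \<preceq> (1 - (1/2) ^ n) *\<^sub>R f 0 + ((1/2) ^ Suc n) *\<^sub>R (f 0 + f (2 ^ Suc n))"
      by (rule cstar_le_add_mono[OF cstar_le_refl])
    also have "\<dots> = (1 - (1/2) ^ Suc n) *\<^sub>R f 0 + (1/2) ^ Suc n *\<^sub>R f (2 ^ Suc n)"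
      by (simp add: scaleR_right_distrib scaleR_left_diff_distrib)
        (simp flip: scaleR_left_distrib add: field_simps)
    finally show ?case using Suc cstar_le_trans by blast
  qed simp
  have half: "(\<lambda>n. (1/2::real) ^ n) \<longlonglongrightarrow> 0" by (rule LIMSEQ_power_zero) simp
  have "(\<lambda>n. (1/2) ^ n *\<^sub>R f (2 ^ n)) \<longlonglongrightarrow> 0"
  proof (rule Lim_null_comparison)
    show "\<forall>\<^sub>F n in sequentially. norm ((1/2) ^ n *\<^sub>R f (2 ^ n)) \<le> (1/2) ^ n * M"
      by (simp add: bound)
    show "(\<lambda>n. (1/2) ^ n * M) \<longlonglongrightarrow> 0" using tendsto_mult_left_zero[OF half] .
  qed
  then have "(\<lambda>n. (1 - (1/2) ^ n) *\<^sub>R f 0 + (1/2) ^ n *\<^sub>R f (2 ^ n)) \<longlonglongrightarrow> (1 - 0) *\<^sub>R f 0 + 0"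
    by (intro tendsto_intros half)
  then have "(\<lambda>n. (1 - (1/2) ^ n) *\<^sub>R f 0 + (1/2) ^ n *\<^sub>R f (2 ^ n)) \<longlonglongrightarrow> f 0" by simp
  from cstar_le_lim[OF le tendsto_const this] show ?thesis .
qed

section \<open>Hilbert modules\<close>

context hilbert_module
begin

lemma carrier_zero [simp]: "0 \<in> hcarrier X"
  using subspace_carrier complex_vector.subspace_0 by blast

lemma carrier_add [simp]: "x \<in> hcarrier X \<Longrightarrow> y \<in> hcarrier X \<Longrightarrow> x + y \<in> hcarrier X"
  using subspace_carrier complex_vector.subspace_add by blast

lemma carrier_diff [simp]: "x \<in> hcarrier X \<Longrightarrow> y \<in> hcarrier X \<Longrightarrow> x - y \<in> hcarrier X"
  using subspace_carrier complex_vector.subspace_diff by blast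

lemma carrier_scaleC [simp]: "x \<in> hcarrier X \<Longrightarrow> c *c x \<in> hcarrier X"
  using subspace_carrier complex_vector.subspace_scale by blast

lemma carrier_sum: "(\<And>i. i \<in> I \<Longrightarrow> f i \<in> hcarrier X) \<Longrightarrow> sum f I \<in> hcarrier X"
  using subspace_carrier complex_vector.subspace_sum by metis

declare act_closed [simp]

lemma ip_add_left:
  assumes "x \<in> hcarrier X" "y \<in> hcarrier X" "z \<in> hcarrier X"
  shows "hip X (x + y) z = hip X x z + hip X y z"
  using assms by (simp add: ip_sym[of z] ip_add_right cstar_add)

lemma ip_diff_right:
  assumes "x \<in> hcarrier X" "y \<in> hcarrier X" "z \<in> hcarrier X"
  shows "hip X x (y - z) = hip X x y - hip X x z"
  using ip_add_right[of x "y - z" z] assms by simp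

lemma ip_diff_left:
  assumes "x \<in> hcarrier X" "y \<in> hcarrier X" "z \<in> hcarrier X"
  shows "hip X (x - y) z = hip X x z - hip X y z"
  using ip_add_left[of "x - y" y z] assms by simp

lemma ip_zero_right [simp]: "x \<in> hcarrier X \<Longrightarrow> hip X x 0 = 0"
  using ip_diff_right[of x 0 0] by simp

lemma ip_zero_left [simp]: "x \<in> hcarrier X \<Longrightarrow> hip X 0 x = 0"
  using ip_diff_left[of 0 0 x] by simp

lemma ip_scaleC_left:
  assumes "x \<in> hcarrier X" "y \<in> hcarrier X"
  shows "hip X (c *c x) y = cnj c *c hip X x y"
  using assms by (simp add: ip_sym[of y] ip_scaleC_right cstar_scaleC)

lemma ip_act_left:
  assumes "x \<in> hcarrier X" "y \<in> hcarrier X"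
  shows "hip X (hact X x a) y = a\<^sup>\<star> * hip X x y"
  using assms by (simp add: ip_sym[of y] ip_act_right cstar_mult)

lemma ip_sum_right:
  assumes "x \<in> hcarrier X" "\<And>i. i \<in> I \<Longrightarrow> f i \<in> hcarrier X"
  shows "hip X x (sum f I) = (\<Sum>i\<in>I. hip X x (f i))"
  using assms(2)
  by (induction I rule: infinite_finite_induct) (simp_all add: assms(1) ip_add_right carrier_sum)

lemma ip_eqI:
  assumes "x \<in> hcarrier X" "y \<in> hcarrier X" "\<And>z. z \<in> hcarrier X \<Longrightarrow> hip X z x = hip X z y"
  shows "x = y"
proof -
  have "hip X (x - y) (x - y) = 0" using assms by (simp add: ip_diff_right)
  then show ?thesis using ip_definite[of "x - y"] assms(1,2) by simp
qed

lemma hnorm_nonneg [simp]: "0 \<le> hnorm X x"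
  by (simp add: hnorm_def)

lemma hnorm_power2: "(hnorm X x)\<^sup>2 = norm (hip X x x)"
  by (simp add: hnorm_def)

lemma hnorm_zero [simp]: "hnorm X 0 = 0"
  by (simp add: hnorm_def)

lemma hnorm_eq_0: "x \<in> hcarrier X \<Longrightarrow> hnorm X x = 0 \<longleftrightarrow> x = 0"
  using ip_definite by (auto simp: hnorm_def)

lemma norm_ip_le:
  assumes x: "x \<in> hcarrier X" and y: "y \<in> hcarrier X"
  shows "norm (hip X x y) \<le> hnorm X x * hnorm X y"
proof -
  have "(norm (hip X x y))\<^sup>2 \<le> norm (hip X x x) * norm (hip X y y)"
  proof (rule cstar_cauchy_schwarz[OF ip_pos[OF x]])
    fix a
    have "hip X (hact X x a - y) (hact X x a - y)
        = a\<^sup>\<star> * hip X x x * a - a\<^sup>\<star> * hip X x y - (hip X x y)\<^sup>\<star> * a + hip X y y"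
      using x y by (simp add: ip_diff_left ip_diff_right ip_act_left ip_act_right algebra_simps ip_sym[of x y])
    then show "0 \<preceq> a\<^sup>\<star> * hip X x x * a - a\<^sup>\<star> * hip X x y - (hip X x y)\<^sup>\<star> * a + hip X y y"
      using ip_pos[of "hact X x a - y"] x y by simp
  qed
  then have "(norm (hip X x y))\<^sup>2 \<le> (hnorm X x * hnorm X y)\<^sup>2"
    by (simp add: power_mult_distrib hnorm_power2)
  then show ?thesis by (rule power2_le_imp_le) simp
qed

lemma hnorm_triangle:
  assumes x: "x \<in> hcarrier X" and y: "y \<in> hcarrier X"
  shows "hnorm X (x + y) \<le> hnorm X x + hnorm X y"
proof (rule power2_le_imp_le)
  have "(hnorm X (x + y))\<^sup>2 = norm (hip X x x + hip X x y + hip X y x + hip X y y)"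
    using x y by (simp add: hnorm_power2 ip_add_left ip_add_right ac_simps)
  also have "\<dots> \<le> norm (hip X x x) + norm (hip X x y) + norm (hip X y x) + norm (hip X y y)"
    by (intro norm_triangle_le add_mono order_refl)
  also have "\<dots> \<le> (hnorm X x)\<^sup>2 + hnorm X x * hnorm X y + hnorm X y * hnorm X x + (hnorm X y)\<^sup>2"
    unfolding hnorm_power2 by (intro add_mono order_refl norm_ip_le x y)
  also have "\<dots> = (hnorm X x + hnorm X y)\<^sup>2" by (simp add: power2_eq_square algebra_simps)
  finally show "(hnorm X (x + y))\<^sup>2 \<le> (hnorm X x + hnorm X y)\<^sup>2" .
qed simp

lemma hnorm_scaleC: "x \<in> hcarrier X \<Longrightarrow> hnorm X (c *c x) = cmod c * hnorm X x"
  by (simp add: hnorm_def ip_scaleC_left ip_scaleC_right scaleC_scaleC norm_scaleC norm_mult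
      real_sqrt_mult)

lemma hnorm_diff_commute:
  assumes "x \<in> hcarrier X" "y \<in> hcarrier X" shows "hnorm X (x - y) = hnorm X (y - x)"
  using hnorm_scaleC[of "x - y" "- 1"] assms by (simp add: complex_vector.scale_minus_left scaleC_one)

text \<open>Used by the gliding hump and by the fixed-point iteration. The explicit error is what
  lets the former compare the limit with a single partial sum.\<close>

lemma geometric_limit:
  assumes s: "\<And>n. s n \<in> hcarrier X" and step: "\<And>n. hnorm X (s (Suc n) - s n) \<le> K * r ^ n"
    and r: "0 \<le> r" "r < 1"
  obtains l where "l \<in> hcarrier X" "\<And>n. hnorm X (s n - l) \<le> K * r ^ n / (1 - r)"
proof -
  have K: "K \<ge> 0" using order_trans[OF hnorm_nonneg step[of 0]] by simp
  \<comment> \<open>The exact partial geometric sum is needed for the induction to close; the term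
    \<open>r ^ (n + d)\<close> is dropped afterwards.\<close>
  have le: "hnorm X (s (n + d) - s n) \<le> K * (r ^ n - r ^ (n + d)) / (1 - r)" for n d
  proof (induction d)
    case (Suc d)
    have "hnorm X (s (n + Suc d) - s n) \<le> hnorm X (s (Suc (n + d)) - s (n + d)) + hnorm X (s (n + d) - s n)"
      using hnorm_triangle[of "s (Suc (n + d)) - s (n + d)" "s (n + d) - s n"] s by simp
    also have "\<dots> \<le> K * r ^ (n + d) + K * (r ^ n - r ^ (n + d)) / (1 - r)"
      by (intro add_mono step Suc)
    also have "\<dots> = K * (r ^ n - r ^ (n + Suc d)) / (1 - r)" using r by (simp add: field_simps)
    finally show ?case .
  qed simp
  have tail: "hnorm X (s m - s n) \<le> K * r ^ n / (1 - r)" if "m \<ge> n" for m n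
  proof -
    have "K * (r ^ n - r ^ m) / (1 - r) \<le> K * r ^ n / (1 - r)"
      using K r by (intro divide_right_mono mult_left_mono) auto
    then show ?thesis using le[of n "m - n"] that by simp
  qed
  have lim0: "(\<lambda>n. K * r ^ n / (1 - r)) \<longlonglongrightarrow> 0"
    using tendsto_divide[OF tendsto_mult[OF tendsto_const LIMSEQ_power_zero[of r]] tendsto_const, of "1 - r" K] r
    by simp
  have "\<exists>l\<in>hcarrier X. (\<lambda>n. hnorm X (s n - l)) \<longlonglongrightarrow> 0"
  proof (rule complete[OF s])
    fix e :: real assume "e > 0"
    then obtain M where M: "\<And>n. n \<ge> M \<Longrightarrow> K * r ^ n / (1 - r) < e"
      using LIMSEQ_D[OF lim0, of e] by (auto dest!: abs_ge_self[THEN le_less_trans] simp del: abs_divide)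
    show "\<exists>M. \<forall>m\<ge>M. \<forall>n\<ge>M. hnorm X (s m - s n) < e"
    proof (intro exI[of _ M] allI impI)
      fix m n assume mn: "m \<ge> M" "n \<ge> M"
      show "hnorm X (s m - s n) < e"
      proof (cases "n \<le> m")
        case True
        then show ?thesis using tail[OF True] M[OF mn(2)] by simp
      next
        case False
        then have "m \<le> n" by simp
        then show ?thesis using tail[of m n] M[OF mn(1)] hnorm_diff_commute[OF s s, of m n] by simp
      qed
    qed
  qed
  then obtain l where l: "l \<in> hcarrier X" "(\<lambda>n. hnorm X (s n - l)) \<longlonglongrightarrow> 0" by blast
  have "hnorm X (s n - l) \<le> K * r ^ n / (1 - r)" for n
  proof (rule LIMSEQ_le_const)
    show "(\<lambda>m. K * r ^ n / (1 - r) + hnorm X (s m - l)) \<longlonglongrightarrow> K * r ^ n / (1 - r)"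
      using tendsto_add[OF tendsto_const l(2)] by simp
    show "\<exists>N. \<forall>m\<ge>N. hnorm X (s n - l) \<le> K * r ^ n / (1 - r) + hnorm X (s m - l)"
    proof (intro exI[of _ n] allI impI)
      fix m assume "n \<le> m"
      then show "hnorm X (s n - l) \<le> K * r ^ n / (1 - r) + hnorm X (s m - l)"
        using hnorm_triangle[of "s n - s m" "s m - l"] tail[of n m] hnorm_diff_commute[OF s s, of n m] s l(1)
        by simp
    qed
  qed
  then show ?thesis using that l(1) by blast
qed

lemma tendsto_ip_right:
  assumes x: "x \<in> hcarrier X" and s: "\<And>n. s n \<in> hcarrier X" and l: "l \<in> hcarrier X"
    and lim: "(\<lambda>n. hnorm X (s n - l)) \<longlonglongrightarrow> 0"
  shows "(\<lambda>n. hip X x (s n)) \<longlonglongrightarrow> hip X x l"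
proof (rule Lim_null[THEN iffD2], rule Lim_null_comparison)
  show "\<forall>\<^sub>F n in sequentially. norm (hip X x (s n) - hip X x l) \<le> hnorm X x * hnorm X (s n - l)"
    using norm_ip_le[OF x, of "s _ - l"] x s l by (simp add: ip_diff_right)
  show "(\<lambda>n. hnorm X x * hnorm X (s n - l)) \<longlonglongrightarrow> 0"
    using tendsto_mult_right_zero[OF lim] .
qed

subsection \<open>Symmetric operators\<close>

definition symmetric :: "('x \<Rightarrow> 'x) \<Rightarrow> bool" where
  "symmetric R \<longleftrightarrow> R \<in> hcarrier X \<rightarrow> hcarrier X \<and>
     (\<forall>x\<in>hcarrier X. \<forall>y\<in>hcarrier X. hip X (R x) y = hip X x (R y))"

lemma symmetric_closed [simp]: "symmetric R \<Longrightarrow> x \<in> hcarrier X \<Longrightarrow> R x \<in> hcarrier X"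
  by (auto simp: symmetric_def)

lemma symmetric_ip: "symmetric R \<Longrightarrow> x \<in> hcarrier X \<Longrightarrow> y \<in> hcarrier X \<Longrightarrow> hip X x (R y) = hip X (R x) y"
  by (simp add: symmetric_def)

text \<open>Linearity is obtained by pairing with every vector: \<open>R\<close> moves to the other
  argument, where it no longer meets the sum, and definiteness concludes. The same argument gives
  the next two lemmas.\<close>

lemma symmetric_diff:
  "symmetric R \<Longrightarrow> x \<in> hcarrier X \<Longrightarrow> y \<in> hcarrier X \<Longrightarrow> R (x - y) = R x - R y"
  by (rule ip_eqI) (simp_all add: symmetric_ip ip_diff_right)

lemma symmetric_scaleC: "symmetric R \<Longrightarrow> x \<in> hcarrier X \<Longrightarrow> R (c *c x) = c *c R x"
  by (rule ip_eqI) (simp_all add: symmetric_ip ip_scaleC_right)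

lemma symmetric_act: "symmetric R \<Longrightarrow> x \<in> hcarrier X \<Longrightarrow> R (hact X x a) = hact X (R x) a"
  by (rule ip_eqI) (simp_all add: symmetric_ip ip_act_right)

text \<open>Hellinger--Toeplitz by a gliding hump: otherwise there are unit vectors \<open>e\<^sub>n\<close> with
  \<open>\<parallel>R e\<^sub>n\<parallel> > 4\<^sup>n\<close>, and a suitable sum \<open>l\<close> of \<open>\<plusminus> y\<^sub>n\<close> with \<open>\<parallel>y\<^sub>n\<parallel> = 3\<^sup>-\<^sup>n\<close> makes \<open>\<langle>e\<^sub>n, R l\<rangle>\<close> unbounded.\<close>

lemma symmetric_bounded:
  assumes R: "symmetric R"
  obtains K where "K > 0" "\<And>x. x \<in> hcarrier X \<Longrightarrow> hnorm X (R x) \<le> K * hnorm X x"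
proof (rule ccontr)
  assume "\<not> thesis"
  then have unbdd: "\<exists>x\<in>hcarrier X. K * hnorm X x < hnorm X (R x)" if "K > 0" for K
    using that \<open>\<And>K. K > 0 \<Longrightarrow> (\<And>x. x \<in> hcarrier X \<Longrightarrow> hnorm X (R x) \<le> K * hnorm X x) \<Longrightarrow> thesis\<close>
    by (meson not_le)
  have "\<exists>e\<in>hcarrier X. hnorm X e \<le> 1 \<and> 4 ^ n < hnorm X (R e)" for n :: nat
  proof -
    obtain x where x: "x \<in> hcarrier X" "4 ^ n * hnorm X x < hnorm X (R x)"
      using unbdd[of "4 ^ n"] by auto
    have R0: "R 0 = 0" using symmetric_diff[OF R, of 0 0] by simp
    have "x \<noteq> 0" using x R0 by auto
    then have hx: "hnorm X x > 0" using hnorm_eq_0[OF x(1)] by (simp add: less_le)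
    define e where "e = complex_of_real (1 / hnorm X x) *c x"
    have "hnorm X e = 1" using hx x(1) by (simp add: e_def hnorm_scaleC norm_divide)
    moreover have "hnorm X (R e) = hnorm X (R x) / hnorm X x"
      using hx x(1) R by (simp add: e_def symmetric_scaleC hnorm_scaleC norm_divide)
    moreover have "4 ^ n < hnorm X (R x) / hnorm X x" using x(2) hx by (simp add: pos_less_divide_eq)
    moreover have "e \<in> hcarrier X" using x(1) by (simp add: e_def)
    ultimately show ?thesis by (intro bexI[of _ e]) simp_all
  qed
  then obtain e where e: "\<And>n. e n \<in> hcarrier X" "\<And>n. hnorm X (e n) \<le> 1" "\<And>n. 4 ^ n < hnorm X (R (e n))"
    by metis
  define h where "h n = hnorm X (R (e n))" for n
  have h: "h n > 0" for n using e(3)[of n] by (simp add: h_def) (meson less_trans zero_less_power zero_less_numeral)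
  \<comment> \<open>Among vectors of norm \<open>(1/3) ^ n\<close>, this multiple makes the
    functional \<open>\<phi> n\<close> as large as Cauchy-Schwarz permits.\<close>
  define y where "y n = complex_of_real ((1/3) ^ n / h n) *c R (e n)" for n
  have yC: "y n \<in> hcarrier X" for n using R e by (simp add: y_def)
  have ny: "hnorm X (y n) = (1/3) ^ n" for n
    using R e h[of n] by (simp add: y_def hnorm_scaleC norm_mult norm_divide norm_power h_def)
  define \<phi> where "\<phi> n z = hip X (R (e n)) z" for n z
  have \<phi>y: "norm (\<phi> n (y n)) = (1/3) ^ n * h n" for n
  proof -
    have "norm (\<phi> n (y n)) = (1/3) ^ n / h n * (h n)\<^sup>2"
      using R e h[of n]
      by (simp add: \<phi>_def y_def ip_scaleC_right norm_scaleC norm_mult norm_divide norm_power h_def hnorm_power2)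
    then show ?thesis using h[of n] by (simp add: power2_eq_square)
  qed
  \<comment> \<open>The values of \<open>\<phi> n\<close> at \<open>z + y n\<close> and
    \<open>z - y n\<close> differ by twice its value at \<open>y n\<close>, so at least one sign
    gives a value as large as that of \<open>y n\<close>, whatever \<open>z\<close> is.\<close>
  define s where "s = rec_nat 0 (\<lambda>n z. if (1/3) ^ n * h n \<le> norm (\<phi> n (z + y n)) then z + y n else z - y n)"
  have s: "s 0 = 0"
    "s (Suc n) = (if (1/3) ^ n * h n \<le> norm (\<phi> n (s n + y n)) then s n + y n else s n - y n)" for n
    by (simp_all add: s_def)
  have sC: "s n \<in> hcarrier X" for n by (induction n) (simp_all add: s yC)
  have big: "(1/3) ^ n * h n \<le> norm (\<phi> n (s (Suc n)))" for n
  proof (cases "(1/3) ^ n * h n \<le> norm (\<phi> n (s n + y n))")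
    case True then show ?thesis by (simp add: s)
  next
    case False
    have "\<phi> n (s n + y n) - \<phi> n (s n - y n) = 2 *\<^sub>R \<phi> n (y n)"
      using R e sC yC by (simp add: \<phi>_def ip_add_right ip_diff_right scaleR_2)
    then have "2 * ((1/3) ^ n * h n) \<le> norm (\<phi> n (s n + y n)) + norm (\<phi> n (s n - y n))"
      using norm_triangle_ineq4[of "\<phi> n (s n + y n)" "\<phi> n (s n - y n)"] \<phi>y[of n] by simp
    then have "(1/3) ^ n * h n \<le> norm (\<phi> n (s n - y n))" using False by linarith
    then show ?thesis using False by (simp add: s)
  qed
  have step: "hnorm X (s (Suc n) - s n) \<le> 1 * (1/3) ^ n" for n
    using hnorm_diff_commute[of 0 "y n"] by (simp add: s ny yC)
  obtain l where l: "l \<in> hcarrier X" "\<And>n. hnorm X (s n - l) \<le> 1 * (1/3) ^ n / (1 - 1/3)"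
    using geometric_limit[OF sC step] by auto
  have bnd: "(4/3) ^ n \<le> 2 * hnorm X (R l)" for n
  proof -
    \<comment> \<open>The ratio 1/3 matters: the remaining steps have total length at most half of
      \<open>(1/3) ^ n\<close>, so passing to the limit destroys only half of the value secured at
      stage \<open>n\<close>.\<close>
    have "norm (\<phi> n (s (Suc n)) - \<phi> n l) \<le> h n * hnorm X (s (Suc n) - l)"
      using norm_ip_le[of "R (e n)" "s (Suc n) - l"] R e sC[of "Suc n"] l(1)
      by (simp add: \<phi>_def ip_diff_right h_def)
    also have "\<dots> \<le> h n * ((1/3) ^ n / 2)"
      using l(2)[of "Suc n"] h[of n] by (intro mult_left_mono) simp_all
    also have "\<dots> = (1/3) ^ n * h n / 2" by simp
    finally have "(1/3) ^ n * h n / 2 \<le> norm (\<phi> n l)"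
      using big[of n] norm_triangle_ineq2[of "\<phi> n (s (Suc n))" "\<phi> n l"] by linarith
    also have "\<phi> n l = hip X (e n) (R l)" using R e l by (simp add: \<phi>_def symmetric_ip)
    also have "norm \<dots> \<le> 1 * hnorm X (R l)"
      using R e l by (intro order_trans[OF norm_ip_le] mult_right_mono) simp_all
    finally have "(1/3) ^ n * h n \<le> 2 * hnorm X (R l)" by simp
    moreover have "(1/3) ^ n * 4 ^ n \<le> (1/3) ^ n * h n"
      using e(3)[of n] by (intro mult_left_mono) (simp_all add: h_def)
    ultimately show ?thesis by (simp add: power_mult_distrib[symmetric])
  qed
  obtain n where "2 * hnorm X (R l) < (4/3) ^ n" using real_arch_pow[of "4/3"] by auto
  then show False using bnd[of n] by simp
qed

text \<open>\<open>\<langle>x, R x\<rangle> \<preceq> K \<langle>x, x\<rangle>\<close> follows from norm boundedness because \<open>f k = K\<^sup>-\<^sup>k \<langle>x, R\<^sup>k x\<rangle>\<close> is bounded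
  and \<open>2 f k \<preceq> f 0 + f (2 k)\<close>.\<close>

lemma symmetric_ip_le:
  assumes R: "symmetric R" and K: "K > 0"
    and bound: "\<And>x. x \<in> hcarrier X \<Longrightarrow> hnorm X (R x) \<le> K * hnorm X x"
    and x: "x \<in> hcarrier X"
  shows "hip X x (R x) \<preceq> K *\<^sub>R hip X x x"
proof -
  define f where "f k = (1 / K ^ k) *\<^sub>R hip X x ((R ^^ k) x)" for k
  have C: "(R ^^ k) x \<in> hcarrier X" for k by (induction k) (simp_all add: x R)
  have sym: "hip X ((R ^^ k) y) z = hip X y ((R ^^ k) z)"
    if "y \<in> hcarrier X" "z \<in> hcarrier X" for k y z
    using that
  proof (induction k arbitrary: z)
    case (Suc k)
    have "(R ^^ k) y \<in> hcarrier X" using Suc.prems(1) by (induction k) (simp_all add: R)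
    then have "hip X ((R ^^ Suc k) y) z = hip X ((R ^^ k) y) (R z)"
      using Suc.prems R by (simp add: symmetric_ip)
    also have "\<dots> = hip X y ((R ^^ k) (R z))" using Suc R by simp
    finally show ?case by (simp add: funpow_Suc_right del: funpow.simps)
  qed simp
  have "2 *\<^sub>R f k \<preceq> f 0 + f (2 * k)" for k
  proof -
    \<comment> \<open>The doubling inequality is positivity of <x - z, x - z>: symmetry turns <z, z>
      into \<open>f (2 * k)\<close> and both mixed terms into \<open>f k\<close>.\<close>
    define z where "z = complex_of_real (1 / K ^ k) *c (R ^^ k) x"
    have z: "z \<in> hcarrier X" by (simp add: z_def C)
    have "hip X z z = (1 / K ^ k) *\<^sub>R (1 / K ^ k) *\<^sub>R hip X x ((R ^^ k) ((R ^^ k) x))"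
      using C x by (simp add: z_def ip_scaleC_left ip_scaleC_right sym scaleC_of_real del: of_real_divide)
    also have "\<dots> = f (2 * k)" by (simp add: f_def mult_2 power_add funpow_add)
    finally have "hip X z z = f (2 * k)" .
    moreover have "hip X x z = f k" "hip X z x = f k"
      using C x by (simp_all add: z_def f_def ip_scaleC_left ip_scaleC_right sym scaleC_of_real del: of_real_divide)
    moreover have "hip X x x = f 0" by (simp add: f_def)
    ultimately have "hip X (x - z) (x - z) = f 0 + f (2 * k) - 2 *\<^sub>R f k"
      using x z by (simp add: ip_diff_left ip_diff_right scaleR_2)
    then show ?thesis using ip_pos[of "x - z"] x z cstar_le_iff_diff[of "2 *\<^sub>R f k"] by simp
  qed
  moreover have "norm (f k) \<le> (hnorm X x)\<^sup>2" for k
  proof -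
    have "hnorm X ((R ^^ k) x) \<le> K ^ k * hnorm X x"
    proof (induction k)
      case (Suc k)
      have "hnorm X (R ((R ^^ k) x)) \<le> K * (K ^ k * hnorm X x)"
        using Suc K by (intro order_trans[OF bound[OF C]] mult_left_mono) simp_all
      then show ?case by (simp add: mult.assoc)
    qed simp
    then have "norm (hip X x ((R ^^ k) x)) \<le> hnorm X x * (K ^ k * hnorm X x)"
      by (intro order_trans[OF norm_ip_le[OF x C]] mult_left_mono) simp_all
    then show ?thesis using K by (simp add: f_def field_simps power2_eq_square)
  qed
  ultimately have "f 1 \<preceq> f 0" by (rule cstar_le_of_doubling)
  then have "K *\<^sub>R f 1 \<preceq> K *\<^sub>R f 0" using K by (intro cstar_le_scaleR_mono) simp_all
  then show ?thesis using K by (simp add: f_def)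
qed

lemma symmetric_ip_bounded:
  assumes R: "symmetric R"
  obtains K where "K > 0" "\<And>x. x \<in> hcarrier X \<Longrightarrow> hip X x (R x) \<preceq> K *\<^sub>R hip X x x"
proof -
  obtain K where "K > 0" "\<And>x. x \<in> hcarrier X \<Longrightarrow> hnorm X (R x) \<le> K * hnorm X x"
    using symmetric_bounded[OF R] by blast
  then show ?thesis using that symmetric_ip_le[OF R] by blast
qed

end

lemma cstar_sum_le_suminf:
  fixes f :: "nat \<Rightarrow> 'a::cstar_algebra"
  assumes "summable f" "\<And>n. 0 \<preceq> f n" "finite F"
  shows "sum f F \<preceq> suminf f"
proof -
  obtain M where M: "F \<subseteq> {..<M}" using \<open>finite F\<close> finite_nat_iff_bounded by blast
  have "sum f F \<preceq> sum f {..<n + M}" for n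
  proof -
    have F: "F \<subseteq> {..<n + M}" using M by force
    show ?thesis unfolding cstar_le_iff_diff[of "sum f F"]
      by (subst sum_diff[symmetric]) (use F assms in \<open>auto intro: cstar_nonneg_sum\<close>)
  qed
  then show ?thesis
    by (rule cstar_le_lim[OF _ tendsto_const LIMSEQ_ignore_initial_segment[OF summable_LIMSEQ[OF assms(1)]]])
qed

lemma cstar_suminf_nonneg:
  fixes f :: "nat \<Rightarrow> 'a::cstar_algebra"
  assumes "summable f" "\<And>n. 0 \<preceq> f n"
  shows "0 \<preceq> suminf f"
  using cstar_sum_le_suminf[OF assms, of "{}"] by simp

section \<open>The module \<open>\<ell>\<^sup>2\<close>\<close>

lemma ell2_simps [simp]:
  "a \<in> hcarrier ell2 \<longleftrightarrow> summable (\<lambda>n. (a n)\<^sup>\<star> * a n)"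
  "hip ell2 a b = (\<Sum>n. (a n)\<^sup>\<star> * b n)"
  by (simp_all add: ell2_def)

text \<open>The norms of the terms need not be summable, so the Cauchy criterion is verified for the
  sums over blocks, by Cauchy-Schwarz.\<close>

lemma summable_ell2_ip:
  fixes p q :: "nat \<Rightarrow> 'a::cstar_algebra"
  assumes p: "summable (\<lambda>n. (p n)\<^sup>\<star> * p n)" and q: "summable (\<lambda>n. (q n)\<^sup>\<star> * q n)"
  shows "summable (\<lambda>n. (p n)\<^sup>\<star> * q n)"
  unfolding summable_Cauchy
proof (intro allI impI)
  fix e :: real assume "e > 0"
  then obtain N1 N2 where
    N1: "\<And>m n. m \<ge> N1 \<Longrightarrow> norm (\<Sum>n=m..<n. (p n)\<^sup>\<star> * p n) < e" and
    N2: "\<And>m n. m \<ge> N2 \<Longrightarrow> norm (\<Sum>n=m..<n. (q n)\<^sup>\<star> * q n) < e"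
    using p q unfolding summable_Cauchy by meson
  show "\<exists>N. \<forall>m\<ge>N. \<forall>n. norm (\<Sum>n=m..<n. (p n)\<^sup>\<star> * q n) < e"
  proof (intro exI[of _ "max N1 N2"] allI impI)
    fix m n assume "max N1 N2 \<le> m"
    then have "norm (\<Sum>n=m..<n. (p n)\<^sup>\<star> * p n) * norm (\<Sum>n=m..<n. (q n)\<^sup>\<star> * q n) < e * e"
      using N1 N2 by (intro mult_strict_mono') auto
    then have "(norm (\<Sum>n=m..<n. (p n)\<^sup>\<star> * q n))\<^sup>2 < e\<^sup>2"
      using cstar_sum_cauchy_schwarz[of p q "{m..<n}"] by (simp add: power2_eq_square)
    then show "norm (\<Sum>n=m..<n. (p n)\<^sup>\<star> * q n) < e"
      using \<open>e > 0\<close> by (simp add: power_less_imp_less_base)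
  qed
qed

lemma suminf_cstar:
  fixes f :: "nat \<Rightarrow> 'a::cstar_algebra"
  assumes "summable f" shows "(suminf f)\<^sup>\<star> = (\<Sum>n. (f n)\<^sup>\<star>)"
  by (rule bounded_linear.suminf[OF bounded_linear_cstar assms])

lemma ell2_ip_sym:
  fixes p q :: "nat \<Rightarrow> 'a::cstar_algebra"
  assumes "summable (\<lambda>n. (p n)\<^sup>\<star> * p n)" "summable (\<lambda>n. (q n)\<^sup>\<star> * q n)"
  shows "(\<Sum>n. (p n)\<^sup>\<star> * q n)\<^sup>\<star> = (\<Sum>n. (q n)\<^sup>\<star> * p n)"
  by (simp add: suminf_cstar[OF summable_ell2_ip[OF assms]] cstar_mult cstar_cstar)

text \<open>Termwise positivity of the square of
  \<open>sqrt t *\<^sub>R p n - (1 / sqrt t) *\<^sub>R q n\<close>.\<close>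

lemma ell2_am_gm:
  fixes p q :: "nat \<Rightarrow> 'a::cstar_algebra"
  assumes p: "summable (\<lambda>n. (p n)\<^sup>\<star> * p n)" and q: "summable (\<lambda>n. (q n)\<^sup>\<star> * q n)" and t: "t > 0"
  shows "(\<Sum>n. (p n)\<^sup>\<star> * q n) + (\<Sum>n. (q n)\<^sup>\<star> * p n)
    \<preceq> t *\<^sub>R (\<Sum>n. (p n)\<^sup>\<star> * p n) + (1/t) *\<^sub>R (\<Sum>n. (q n)\<^sup>\<star> * q n)"
proof -
  define r where "r n = sqrt t *\<^sub>R p n - (1 / sqrt t) *\<^sub>R q n" for n
  have pq: "summable (\<lambda>n. (p n)\<^sup>\<star> * q n)" "summable (\<lambda>n. (q n)\<^sup>\<star> * p n)"
    using summable_ell2_ip[OF p q] summable_ell2_ip[OF q p] by simp_all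
  have r: "(r n)\<^sup>\<star> * r n = (t *\<^sub>R ((p n)\<^sup>\<star> * p n) + (1/t) *\<^sub>R ((q n)\<^sup>\<star> * q n))
      - ((p n)\<^sup>\<star> * q n + (q n)\<^sup>\<star> * p n)" for n
    using t by (simp add: r_def cstar_diff cstar_scaleR left_diff_distrib right_diff_distrib
        scaleR_right_diff_distrib)
  have s: "summable (\<lambda>n. (r n)\<^sup>\<star> * r n)"
    unfolding r by (intro summable_diff summable_add summable_scaleR_right p q pq)
  have "(\<Sum>n. (r n)\<^sup>\<star> * r n) = (t *\<^sub>R (\<Sum>n. (p n)\<^sup>\<star> * p n) + (1/t) *\<^sub>R (\<Sum>n. (q n)\<^sup>\<star> * q n))
      - ((\<Sum>n. (p n)\<^sup>\<star> * q n) + (\<Sum>n. (q n)\<^sup>\<star> * p n))"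
    unfolding r by (intro sums_unique[symmetric] sums_diff sums_add sums_scaleR_right summable_sums p q pq)
  then show ?thesis
    using cstar_suminf_nonneg[OF s] unfolding cstar_le_iff_diff[of "_ + _"] by simp
qed

section \<open>Multiplier modules\<close>

context hilbert_module
begin

lemma mult_module_closed [simp]: "v \<in> hcarrier (mult_module X) \<Longrightarrow> v a \<in> hcarrier X"
  by (auto simp: mult_module_def adjointable_def self_module_def)

lemma mult_moduleI:
  assumes "\<And>a. v a \<in> hcarrier X" "\<And>c x. x \<in> hcarrier X \<Longrightarrow> hip X (v c) x = c\<^sup>\<star> * S x"
  shows "v \<in> hcarrier (mult_module X)"
proof -
  have "is_adjoint self_module X v S" using assms(2) by (simp add: is_adjoint_def self_module_def)
  moreover have "v \<in> hcarrier self_module \<rightarrow> hcarrier X" by (simp add: assms(1))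
  ultimately have "v \<in> adjointable self_module X" unfolding adjointable_def by blast
  then show ?thesis by (simp add: mult_module_def)
qed

lemma ip_mult_module:
  assumes "v \<in> hcarrier (mult_module X)" "x \<in> hcarrier X"
  shows "hip X x (v a) = (mip X v x)\<^sup>\<star> * a"
  using assms by (simp add: ip_sym[of "v a" x] mip_adjoint cstar_mult cstar_cstar)

lemma mult_module_mult: "v \<in> hcarrier (mult_module X) \<Longrightarrow> v (a * b) = hact X (v a) b"
  by (rule ip_eqI) (simp_all add: ip_mult_module ip_act_right mult.assoc)

lemma zero_in_mult_module: "(\<lambda>a. 0) \<in> hcarrier (mult_module X)"
  by (rule mult_moduleI[where S = "\<lambda>x. 0"]) simp_all

lemma scaleC_in_mult_module:
  "v \<in> hcarrier (mult_module X) \<Longrightarrow> (\<lambda>a. c *c v a) \<in> hcarrier (mult_module X)"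
  by (rule mult_moduleI[where S = "\<lambda>x. cnj c *c mip X v x"])
    (simp_all add: ip_scaleC_left mip_adjoint scaleC_mult_right)

text \<open>Supplies the left vectors of the finite rank operator: the inverse frame operator
  applied to the new vectors.\<close>

lemma symmetric_comp_mult_module:
  "symmetric R \<Longrightarrow> v \<in> hcarrier (mult_module X) \<Longrightarrow> (\<lambda>a. R (v a)) \<in> hcarrier (mult_module X)"
  by (rule mult_moduleI[where S = "\<lambda>x. mip X v (R x)"])
    (simp_all add: symmetric_ip[symmetric] mip_adjoint)

text \<open>The composition of \<open>v\<close> with its adjoint is symmetric on X, and its
  quadratic form is the left-hand side.\<close>

lemma mip_square_bounded:
  assumes v: "v \<in> hcarrier (mult_module X)"
  obtains K where "K > 0"
    "\<And>x. x \<in> hcarrier X \<Longrightarrow> (mip X v x)\<^sup>\<star> * mip X v x \<preceq> K *\<^sub>R hip X x x"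
proof -
  have "symmetric (\<lambda>x. v (mip X v x))"
    using v by (auto simp: symmetric_def ip_mult_module mip_adjoint)
  then obtain K where "K > 0" "\<And>x. x \<in> hcarrier X \<Longrightarrow> hip X x (v (mip X v x)) \<preceq> K *\<^sub>R hip X x x"
    using symmetric_ip_bounded by blast
  then show ?thesis using that[of K] v by (simp add: ip_mult_module)
qed

lemma act_sum: "(\<And>i. i \<in> I \<Longrightarrow> f i \<in> hcarrier X) \<Longrightarrow> hact X (sum f I) a = (\<Sum>i\<in>I. hact X (f i) a)"
proof (induction I rule: infinite_finite_induct)
  case (insert i I) then show ?case by (simp add: act_add_left carrier_sum)
qed (use act_scaleC_left[of 0 0 a] in simp_all)

text \<open>With no unit to evaluate at, the inner products are compared after multiplication by
  every \<open>a\<close>; taking adjoints puts this into the form of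
  \<open>cstar_eqI\<close>.\<close>

lemma mult_embed_inject:
  assumes x: "x \<in> hcarrier X" and y: "y \<in> hcarrier X" and "mult_embed X x = mult_embed X y"
  shows "x = y"
proof (rule ip_eqI[OF x y])
  fix z assume z: "z \<in> hcarrier X"
  have "hip X z x * a = hip X z y * a" for a
    using assms(3) ip_act_right[OF z x, of a] ip_act_right[OF z y, of a]
    by (simp add: mult_embed_def fun_eq_iff)
  then have "a\<^sup>\<star> * (hip X z x)\<^sup>\<star> = a\<^sup>\<star> * (hip X z y)\<^sup>\<star>" for a
    by (simp flip: cstar_mult)
  then show "hip X z x = hip X z y" using cstar_eqI cstar_cstar by metis
qed

lemma frame_ineq_cong:
  assumes "\<And>x. x \<in> hcarrier X \<Longrightarrow> s x = t x"
  shows "frame_ineq X s \<longleftrightarrow> frame_ineq X t" "bessel_ineq X s \<longleftrightarrow> bessel_ineq X t"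
  using assms by (simp_all add: frame_ineq_def bessel_ineq_def)

lemma mip_embed_square:
  "y \<in> hcarrier X \<Longrightarrow> x \<in> hcarrier X \<Longrightarrow>
    hip X x y * hip X y x = (mip X (mult_embed X y) x)\<^sup>\<star> * mip X (mult_embed X y) x"
  by (simp add: mip_embed ip_sym[of y x])

text \<open>Exactly one alternative can apply, according to whether all terms come from X, and on
  embedded vectors the two inequalities coincide. This removes the case distinction from both
  directions of the theorem.\<close>

lemma frame_or_outer_frame_iff:
  "frame_or_outer_frame X v \<longleftrightarrow> (\<forall>n. v n \<in> hcarrier (mult_module X)) \<and>
     frame_ineq X (\<lambda>x n. (mip X (v n) x)\<^sup>\<star> * mip X (v n) x)"
proof (cases "\<forall>n. v n \<in> mult_embed X ` hcarrier X")
  case True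
  then have "\<forall>n. \<exists>y. y \<in> hcarrier X \<and> v n = mult_embed X y" by blast
  then obtain y where "\<forall>n. y n \<in> hcarrier X \<and> v n = mult_embed X (y n)" using choice by meson
  then have y: "\<And>n. y n \<in> hcarrier X" "v = (\<lambda>n. mult_embed X (y n))" by (simp_all add: fun_eq_iff)
  have "frame_ineq X (\<lambda>x n. hip X x (y n) * hip X (y n) x) \<longleftrightarrow>
      frame_ineq X (\<lambda>x n. (mip X (v n) x)\<^sup>\<star> * mip X (v n) x)"
    by (rule frame_ineq_cong) (simp add: y mip_embed_square)
  moreover have "\<not> outer_frame X v" using True by (auto simp: outer_frame_def outer_seq_def)
  moreover have "y' = y" if "frame X y'" "v = (\<lambda>n. mult_embed X (y' n))" for y'
    using that y by (auto simp: frame_def fun_eq_iff intro!: mult_embed_inject)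
  ultimately show ?thesis
    using y embed_in_mult_module by (auto simp: frame_or_outer_frame_def frame_def)
next
  case False
  then have "\<not> (\<exists>y. frame X y \<and> v = (\<lambda>n. mult_embed X (y n)))" by (auto simp: frame_def)
  then show ?thesis
    using False by (auto simp: frame_or_outer_frame_def outer_frame_def outer_seq_def)
qed

lemma bessel_or_outer_besselD:
  assumes "bessel_or_outer_bessel X v"
  shows "v n \<in> hcarrier (mult_module X)"
    and "bessel_ineq X (\<lambda>x n. (mip X (v n) x)\<^sup>\<star> * mip X (v n) x)"
proof -
  have "(\<forall>n. v n \<in> hcarrier (mult_module X)) \<and>
    bessel_ineq X (\<lambda>x n. (mip X (v n) x)\<^sup>\<star> * mip X (v n) x)"
    using assms unfolding bessel_or_outer_bessel_def
  proof (elim disjE exE conjE)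
    fix y assume y: "bessel_seq X y" "v = (\<lambda>n. mult_embed X (y n))"
    then have yC: "y n \<in> hcarrier X" for n by (simp add: bessel_seq_def)
    have "bessel_ineq X (\<lambda>x n. hip X x (y n) * hip X (y n) x) \<longleftrightarrow>
      bessel_ineq X (\<lambda>x n. (mip X (v n) x)\<^sup>\<star> * mip X (v n) x)"
      by (rule frame_ineq_cong) (simp add: y(2) yC mip_embed_square)
    then show ?thesis using y yC by (auto simp: bessel_seq_def embed_in_mult_module)
  qed (auto simp: outer_bessel_seq_def outer_seq_def)
  then show "v n \<in> hcarrier (mult_module X)"
    "bessel_ineq X (\<lambda>x n. (mip X (v n) x)\<^sup>\<star> * mip X (v n) x)" by auto
qed

section \<open>Synthesis of square summable sequences, inversion of bounded below symmetric
  operators\<close>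

text \<open>Yields the adjoint of the analysis operator of \<open>u\<close>: the vector
  \<open>z\<close> is the sum of the \<open>u n (y n)\<close>, whose convergence has to be derived
  from the Bessel bound.\<close>

lemma synthesis_exists:
  assumes u: "\<And>n. u n \<in> hcarrier (mult_module X)"
    and bessel: "bessel_ineq X (\<lambda>x n. (mip X (u n) x)\<^sup>\<star> * mip X (u n) x)"
    and y: "summable (\<lambda>n. (y n)\<^sup>\<star> * y n)"
  shows "\<exists>z\<in>hcarrier X. \<forall>x\<in>hcarrier X. hip X x z = (\<Sum>n. (mip X (u n) x)\<^sup>\<star> * y n)"
proof -
  obtain B where B: "B > 0" "\<And>x. x \<in> hcarrier X \<Longrightarrow> summable (\<lambda>n. (mip X (u n) x)\<^sup>\<star> * mip X (u n) x)"
    "\<And>x. x \<in> hcarrier X \<Longrightarrow> (\<Sum>n. (mip X (u n) x)\<^sup>\<star> * mip X (u n) x) \<preceq> B *\<^sub>R hip X x x"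
    using bessel by (auto simp: bessel_ineq_def)
  define g where "g F = (\<Sum>n\<in>F. u n (y n))" for F
  have gC: "g F \<in> hcarrier X" for F by (simp add: g_def carrier_sum u)
  have ipg: "hip X x (g F) = (\<Sum>n\<in>F. (mip X (u n) x)\<^sup>\<star> * y n)" if "x \<in> hcarrier X" for x F
    using that u by (simp add: g_def ip_sum_right ip_mult_module)
  \<comment> \<open>Duality: the Bessel inequality is applied to the vector \<open>g F\<close>
    itself, and Cauchy-Schwarz for <g F, g F> allows one factor
    \<open>(hnorm X (g F))\<^sup>2\<close> to be cancelled.\<close>
  have bound: "(hnorm X (g F))\<^sup>2 \<le> B * norm (\<Sum>n\<in>F. (y n)\<^sup>\<star> * y n)" if "finite F" for F
  proof (cases "hnorm X (g F) = 0")
    case False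
    have "(\<Sum>n\<in>F. (mip X (u n) (g F))\<^sup>\<star> * mip X (u n) (g F)) \<preceq> B *\<^sub>R hip X (g F) (g F)"
      by (rule cstar_le_trans[OF cstar_sum_le_suminf[OF B(2)[OF gC] cstar_square_nonneg that] B(3)[OF gC]])
    then have "norm (\<Sum>n\<in>F. (mip X (u n) (g F))\<^sup>\<star> * mip X (u n) (g F)) \<le> norm (B *\<^sub>R hip X (g F) (g F))"
      by (intro cstar_norm_mono cstar_nonneg_sum) simp_all
    also have "\<dots> = B * (hnorm X (g F))\<^sup>2" using B(1) by (simp add: hnorm_power2)
    finally have "norm (\<Sum>n\<in>F. (mip X (u n) (g F))\<^sup>\<star> * mip X (u n) (g F)) * norm (\<Sum>n\<in>F. (y n)\<^sup>\<star> * y n)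
       \<le> B * (hnorm X (g F))\<^sup>2 * norm (\<Sum>n\<in>F. (y n)\<^sup>\<star> * y n)" by (rule mult_right_mono) simp
    then have "(norm (hip X (g F) (g F)))\<^sup>2 \<le> B * (hnorm X (g F))\<^sup>2 * norm (\<Sum>n\<in>F. (y n)\<^sup>\<star> * y n)"
      using cstar_sum_cauchy_schwarz[of "\<lambda>n. mip X (u n) (g F)" y F] by (simp add: ipg[OF gC])
    then have "(hnorm X (g F))\<^sup>2 * (hnorm X (g F))\<^sup>2
        \<le> (hnorm X (g F))\<^sup>2 * (B * norm (\<Sum>n\<in>F. (y n)\<^sup>\<star> * y n))"
      by (simp add: hnorm_power2 power2_eq_square[of "norm _"] mult_ac)
    then show ?thesis by (rule mult_left_le_imp_le) (use False in simp)
  qed (use B(1) in simp)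
  have cauchy: "\<exists>M. \<forall>m\<ge>M. \<forall>n. hnorm X (g {m..<n}) < e" if "e > 0" for e
  proof -
    have "e\<^sup>2 / B > 0" using that B(1) by simp
    then obtain M where M: "\<And>m n. m \<ge> M \<Longrightarrow> norm (\<Sum>n=m..<n. (y n)\<^sup>\<star> * y n) < e\<^sup>2 / B"
      using y unfolding summable_Cauchy by meson
    have "hnorm X (g {m..<n}) < e" if "m \<ge> M" for m n
    proof -
      have "(hnorm X (g {m..<n}))\<^sup>2 < e\<^sup>2"
        using bound[of "{m..<n}"] M[OF that, of n] B(1) by (simp add: field_simps)
      then show ?thesis using \<open>e > 0\<close> by (simp add: power_less_imp_less_base)
    qed
    then show ?thesis by blast
  qed
  have gdiff: "g {..<n} - g {..<m} = g {m..<n}" if "m \<le> n" for m n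
    using that by (simp add: g_def flip: sum_diff)
  have "\<exists>z\<in>hcarrier X. (\<lambda>n. hnorm X (g {..<n} - z)) \<longlonglongrightarrow> 0"
  proof (rule complete[OF gC])
    fix e :: real assume "e > 0"
    then obtain M where M: "\<And>m n. m \<ge> M \<Longrightarrow> hnorm X (g {m..<n}) < e" using cauchy by blast
    show "\<exists>M. \<forall>m\<ge>M. \<forall>n\<ge>M. hnorm X (g {..<m} - g {..<n}) < e"
    proof (intro exI[of _ M] allI impI)
      fix m n assume mn: "M \<le> m" "M \<le> n"
      show "hnorm X (g {..<m} - g {..<n}) < e"
      proof (cases "m \<le> n")
        case True
        then show ?thesis using M[OF mn(1), of n] gdiff[of m n] hnorm_diff_commute[OF gC gC] by metis
      next
        case False
        then show ?thesis using M[OF mn(2), of m] gdiff[of n m] by simp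
      qed
    qed
  qed
  then obtain z where z: "z \<in> hcarrier X" "(\<lambda>n. hnorm X (g {..<n} - z)) \<longlonglongrightarrow> 0" by blast
  have "hip X x z = (\<Sum>n. (mip X (u n) x)\<^sup>\<star> * y n)" if x: "x \<in> hcarrier X" for x
  proof -
    have "(\<lambda>n. \<Sum>i<n. (mip X (u i) x)\<^sup>\<star> * y i) \<longlonglongrightarrow> hip X x z"
      using tendsto_ip_right[OF x gC z] by (simp add: ipg[OF x])
    then show ?thesis by (simp add: sums_def sums_unique)
  qed
  then show ?thesis using z(1) by blast
qed

text \<open>A bound on the quadratic form becomes one on the operator: Cauchy-Schwarz for the
  semidefinite form <x, G z>, taken at \<open>y\<close> and \<open>G y\<close>, bounds the fourth
  power of \<open>hnorm X (G y)\<close> by \<open>r\<^sup>2\<close> times the squared norms of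
  \<open>y\<close> and \<open>G y\<close>.\<close>

lemma symmetric_contraction:
  assumes G: "symmetric G" and r: "r \<ge> 0"
    and pos: "\<And>x. x \<in> hcarrier X \<Longrightarrow> 0 \<preceq> hip X x (G x)"
    and le: "\<And>x. x \<in> hcarrier X \<Longrightarrow> hip X x (G x) \<preceq> r *\<^sub>R hip X x x"
    and y: "y \<in> hcarrier X"
  shows "hnorm X (G y) \<le> r * hnorm X y"
proof (cases "hnorm X (G y) = 0")
  case False
  have norm_le: "norm (hip X x (G x)) \<le> r * (hnorm X x)\<^sup>2" if "x \<in> hcarrier X" for x
    using cstar_norm_mono[OF pos[OF that] le[OF that]] r by (simp add: hnorm_power2)
  have "(norm (hip X y (G (G y))))\<^sup>2 \<le> norm (hip X y (G y)) * norm (hip X (G y) (G (G y)))"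
  proof (rule cstar_cauchy_schwarz[OF pos[OF y]])
    fix a
    let ?z = "hact X y a - G y"
    have "hip X ?z (G ?z) = hip X ?z (hact X (G y) a) - hip X ?z (G (G y))"
      using G y by (simp add: symmetric_diff symmetric_act ip_diff_right)
    also have "\<dots> = a\<^sup>\<star> * hip X y (G y) * a - a\<^sup>\<star> * hip X y (G (G y))
        - hip X (G y) (G y) * a + hip X (G y) (G (G y))"
      using G y by (simp add: ip_diff_left ip_act_left ip_act_right left_diff_distrib)
    also have "hip X (G y) (G y) = (hip X y (G (G y)))\<^sup>\<star>"
      using G y by (simp add: symmetric_ip flip: ip_sym)
    finally show "0 \<preceq> a\<^sup>\<star> * hip X y (G y) * a - a\<^sup>\<star> * hip X y (G (G y))
        - (hip X y (G (G y)))\<^sup>\<star> * a + hip X (G y) (G (G y))"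
      using pos[of ?z] G y by simp
  qed
  also have "\<dots> \<le> (r * (hnorm X y)\<^sup>2) * (r * (hnorm X (G y))\<^sup>2)"
    using G y r by (intro mult_mono norm_le) simp_all
  also have "hip X y (G (G y)) = hip X (G y) (G y)" using G y by (simp add: symmetric_ip)
  finally have "((hnorm X (G y))\<^sup>2)\<^sup>2 \<le> (r * (hnorm X y)\<^sup>2) * (r * (hnorm X (G y))\<^sup>2)"
    by (simp add: hnorm_power2)
  then have "(hnorm X (G y))\<^sup>2 * (hnorm X (G y))\<^sup>2 \<le> (r * hnorm X y)\<^sup>2 * (hnorm X (G y))\<^sup>2"
    by (simp add: power2_eq_square mult_ac)
  then have "(hnorm X (G y))\<^sup>2 \<le> (r * hnorm X y)\<^sup>2"
    by (rule mult_right_le_imp_le) (use False in simp)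
  then show ?thesis by (rule power2_le_imp_le) (simp add: r)
qed (simp add: r)

text \<open>\<open>S\<close> is inverted by the fixed-point iteration \<open>x \<mapsto> x - S x / K + y / K\<close>.\<close>

lemma symmetric_inverse:
  assumes S: "symmetric S" and A: "A > 0"
    and lower: "\<And>x. x \<in> hcarrier X \<Longrightarrow> A *\<^sub>R hip X x x \<preceq> hip X x (S x)"
  obtains Q where "symmetric Q" "\<And>x. x \<in> hcarrier X \<Longrightarrow> Q (S x) = x"
proof -
  obtain K0 where K0: "K0 > 0" "\<And>x. x \<in> hcarrier X \<Longrightarrow> hip X x (S x) \<preceq> K0 *\<^sub>R hip X x x"
    using symmetric_ip_bounded[OF S] by blast
  \<comment> \<open>Adding \<open>A\<close> ensures \<open>K > A\<close>, hence
    \<open>0 \<le> r < 1\<close>; the two bounds on \<open>S\<close> turn into the bounds 0 and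
    \<open>r\<close> on the form of \<open>G\<close>.\<close>
  define K where "K = K0 + A"
  have K: "K > 0" "K > A" using K0 A by (simp_all add: K_def)
  have upper: "hip X x (S x) \<preceq> K *\<^sub>R hip X x x" if "x \<in> hcarrier X" for x
    by (rule cstar_le_trans[OF K0(2)[OF that] cstar_le_scaleR_left[OF ip_pos[OF that]]])
      (use A in \<open>simp add: K_def\<close>)
  let ?c = "complex_of_real (1 / K)"
  define G where "G x = x - ?c *c S x" for x
  have G: "symmetric G"
    using S by (auto simp: symmetric_def G_def ip_diff_left ip_diff_right ip_scaleC_left ip_scaleC_right)
  have ipG: "hip X x (G x) = (1/K) *\<^sub>R (K *\<^sub>R hip X x x - hip X x (S x))" if "x \<in> hcarrier X" for x
    using that S K by (simp add: G_def ip_diff_right ip_scaleC_right scaleC_of_real scaleR_right_diff_distrib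
        del: of_real_divide)
  define r where "r = 1 - A / K"
  have r: "0 \<le> r" "r < 1" using K A by (simp_all add: r_def field_simps)
  have contr: "hnorm X (G x) \<le> r * hnorm X x" if "x \<in> hcarrier X" for x
  proof (rule symmetric_contraction[OF G r(1) _ _ that])
    fix x assume x: "x \<in> hcarrier X"
    show "0 \<preceq> hip X x (G x)"
      unfolding ipG[OF x] using upper[OF x] K
      by (intro cstar_nonneg_scaleR) (simp_all add: cstar_le_iff_diff[of "hip X x (S x)"])
    have "(1/K) *\<^sub>R (K *\<^sub>R hip X x x - hip X x (S x)) \<preceq> (1/K) *\<^sub>R (K *\<^sub>R hip X x x - A *\<^sub>R hip X x x)"
      using lower[OF x] K
      by (intro cstar_le_scaleR_mono)
        (simp_all add: cstar_le_iff_diff[of "A *\<^sub>R _"] cstar_le_iff_diff[of "_ - _"])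
    also have "\<dots> = r *\<^sub>R hip X x x"
      using K by (simp add: r_def scaleR_right_diff_distrib scaleR_left_diff_distrib)
    finally show "hip X x (G x) \<preceq> r *\<^sub>R hip X x x" unfolding ipG[OF x] .
  qed
  have surj: "\<exists>l\<in>hcarrier X. S l = y" if y: "y \<in> hcarrier X" for y
  proof -
    define s where "s = rec_nat 0 (\<lambda>_ x. G x + ?c *c y)"
    have s: "s 0 = 0" "s (Suc n) = G (s n) + ?c *c y" for n by (simp_all add: s_def)
    have sC: "s n \<in> hcarrier X" for n by (induction n) (simp_all add: s G y)
    have G0: "G 0 = 0" using symmetric_diff[OF G, of 0 0] by simp
    have step: "hnorm X (s (Suc n) - s n) \<le> hnorm X (?c *c y) * r ^ n" for n
    proof (induction n)
      case (Suc n)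
      have "s (Suc (Suc n)) - s (Suc n) = G (s (Suc n) - s n)"
        unfolding symmetric_diff[OF G sC sC] by (simp add: s(2)[of "Suc n"] s(2)[of n] del: s)
      then have "hnorm X (s (Suc (Suc n)) - s (Suc n)) \<le> r * hnorm X (s (Suc n) - s n)"
        using contr[of "s (Suc n) - s n"] sC by simp
      also have "\<dots> \<le> r * (hnorm X (?c *c y) * r ^ n)" by (rule mult_left_mono[OF Suc r(1)])
      finally show ?case by (simp add: mult_ac)
    qed (simp add: s G0)
    obtain l where l: "l \<in> hcarrier X" "\<And>n. hnorm X (s n - l) \<le> hnorm X (?c *c y) * r ^ n / (1 - r)"
      using geometric_limit[OF sC step r] by blast
    have lim: "(\<lambda>n. hnorm X (s n - l)) \<longlonglongrightarrow> 0"
    proof (rule Lim_null_comparison)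
      show "\<forall>\<^sub>F n in sequentially. norm (hnorm X (s n - l)) \<le> hnorm X (?c *c y) * r ^ n / (1 - r)"
        using l(2) by simp
      show "(\<lambda>n. hnorm X (?c *c y) * r ^ n / (1 - r)) \<longlonglongrightarrow> 0"
        using tendsto_divide[OF tendsto_mult[OF tendsto_const LIMSEQ_power_zero[of r]] tendsto_const, of "1 - r"] r
        by simp
    qed
    define d where "d = G l + ?c *c y"
    have dC: "d \<in> hcarrier X" using G l y by (simp add: d_def)
    have "hnorm X (s (Suc n) - d) \<le> r * hnorm X (s n - l)" for n
      using contr[of "s n - l"] sC l(1) by (simp add: s d_def symmetric_diff[OF G])
    moreover have "hnorm X (l - d) \<le> hnorm X (s (Suc n) - l) + hnorm X (s (Suc n) - d)" for n
      using hnorm_triangle[of "l - s (Suc n)" "s (Suc n) - d"] hnorm_diff_commute[OF l(1) sC, of "Suc n"]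
        l(1) sC[of "Suc n"] dC by simp
    ultimately have le: "hnorm X (l - d) \<le> hnorm X (s (Suc n) - l) + r * hnorm X (s n - l)" for n
      by (meson add_left_mono order_trans)
    have "(\<lambda>n. hnorm X (s (Suc n) - l) + r * hnorm X (s n - l)) \<longlonglongrightarrow> 0 + r * 0"
      by (intro tendsto_intros lim LIMSEQ_Suc[OF lim])
    then have "hnorm X (l - d) \<le> 0 + r * 0" by (rule LIMSEQ_le_const) (use le in blast)
    then have "hnorm X (l - d) = 0" using hnorm_nonneg[of "l - d"] by linarith
    then have "l = d" using hnorm_eq_0[of "l - d"] l(1) dC by simp
    then have "?c *c S l = ?c *c y" by (simp add: d_def G_def algebra_simps)
    then have "S l = y" using K(1) by (simp add: complex_vector.scale_left_imp_eq)
    then show ?thesis using l(1) by blast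
  qed
  have inj: "x = x'" if "x \<in> hcarrier X" "x' \<in> hcarrier X" "S x = S x'" for x x'
  proof -
    have "S (x - x') = 0" using that S by (simp add: symmetric_diff)
    then have "A *\<^sub>R hip X (x - x') (x - x') \<preceq> 0" using lower[of "x - x'"] that by simp
    then have "norm (A *\<^sub>R hip X (x - x') (x - x')) \<le> norm (0::'a)"
      using that A by (intro cstar_norm_mono cstar_nonneg_scaleR ip_pos) simp_all
    then have "hip X (x - x') (x - x') = 0" using A by (simp add: mult_le_0_iff)
    then show ?thesis using ip_definite[of "x - x'"] that by simp
  qed
  obtain Q where Q: "\<And>y. y \<in> hcarrier X \<Longrightarrow> Q y \<in> hcarrier X" "\<And>y. y \<in> hcarrier X \<Longrightarrow> S (Q y) = y"
    using surj by metis
  have "hip X (Q x) y = hip X x (Q y)" if "x \<in> hcarrier X" "y \<in> hcarrier X" for x y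
    using symmetric_ip[OF S, of "Q x" "Q y"] Q that by simp
  then have "symmetric Q" using Q(1) by (auto simp: symmetric_def)
  moreover have "Q (S x) = x" if "x \<in> hcarrier X" for x
    by (rule inj) (use that S Q(1) Q(2)[of "S x"] in simp_all)
  ultimately show ?thesis by (rule that)
qed

end

section \<open>Finite rank operators on M(X) and adjointable operators into
  \<open>ell2\<close>\<close>

context hilbert_module
begin

lemma theta_embed:
  assumes "z \<in> hcarrier (mult_module X)" "x \<in> hcarrier X"
  shows "theta (mult_module X) w z (mult_embed X x) a = w (mip X z x * a)"
  using mip_eq[OF assms] by (simp add: theta_def mult_module_def)

text \<open>Induction over the span, with scalars absorbed into \<open>w\<close>. The families are
  total on nat; their entries from \<open>N\<close> on are arbitrary elements of M(X).\<close>

lemma finite_rank_ops_embed: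
  assumes "\<theta> \<in> finite_rank_ops (mult_module X)"
  obtains N :: nat and w z where
    "\<And>i. w i \<in> hcarrier (mult_module X)" "\<And>i. z i \<in> hcarrier (mult_module X)"
    "\<And>x a. x \<in> hcarrier X \<Longrightarrow> \<theta> (mult_embed X x) a = (\<Sum>i<N. w i (mip X (z i) x * a))"
proof -
  let ?M = "hcarrier (mult_module X)"
  let ?P = "\<lambda>\<theta>. \<exists>(N::nat) w z. (\<forall>i. w i \<in> ?M) \<and> (\<forall>i. z i \<in> ?M) \<and>
     (\<forall>x\<in>hcarrier X. \<forall>a. \<theta> (mult_embed X x) a = (\<Sum>i<N. w i (mip X (z i) x * a)))"
  have "?P \<theta>"
    using assms unfolding finite_rank_ops_def
  proof (induction rule: complex_vector.span_induct_alt)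
    case base
    show ?case
      by (intro exI[of _ 0] exI[of _ "\<lambda>_ _. 0"]) (simp add: zero_in_mult_module zero_fun_def)
  next
    case (step c \<eta> \<theta>)
    obtain w0 z0 where \<eta>: "\<eta> = theta (mult_module X) w0 z0" "w0 \<in> ?M" "z0 \<in> ?M" using step.hyps by blast
    obtain N :: nat and w z where wz: "\<And>i. w i \<in> ?M" "\<And>i. z i \<in> ?M"
      "\<And>x a. x \<in> hcarrier X \<Longrightarrow> \<theta> (mult_embed X x) a = (\<Sum>i<N. w i (mip X (z i) x * a))"
      using step.IH by blast
    let ?w = "w(N := \<lambda>a. c *c w0 a)" and ?z = "z(N := z0)"
    have "(c *c \<eta> + \<theta>) (mult_embed X x) a = (\<Sum>i<Suc N. ?w i (mip X (?z i) x * a))"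
      if x: "x \<in> hcarrier X" for x a
    proof -
      have "(\<Sum>i<N. ?w i (mip X (?z i) x * a)) = (\<Sum>i<N. w i (mip X (z i) x * a))"
        by (rule sum.cong) simp_all
      then show ?thesis
        by (simp add: \<eta>(1) theta_embed[OF \<eta>(3) x] wz(3)[OF x] scaleC_fun_def add.commute)
    qed
    moreover have "\<forall>i. ?w i \<in> ?M" "\<forall>i. ?z i \<in> ?M"
      using wz \<eta>(2,3) by (simp_all add: scaleC_in_mult_module)
    ultimately show ?case by (intro exI[of _ "Suc N"] exI[of _ ?w] exI[of _ ?z]) blast
  qed
  then show ?thesis using that by blast
qed

lemma adj_ell2:
  assumes V: "V \<in> adjointable X ell2" and y: "summable (\<lambda>n. (y n)\<^sup>\<star> * y n)"
  shows "adj X ell2 V y \<in> hcarrier X"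
    and "x \<in> hcarrier X \<Longrightarrow> hip X x (adj X ell2 V y) = (\<Sum>n. (V x n)\<^sup>\<star> * y n)"
proof -
  have "\<exists>S. is_adjoint X ell2 V S" using V by (simp add: adjointable_def)
  then have "is_adjoint X ell2 V (adj X ell2 V)" unfolding adj_def by (rule someI_ex)
  then show "adj X ell2 V y \<in> hcarrier X"
    "x \<in> hcarrier X \<Longrightarrow> hip X x (adj X ell2 V y) = (\<Sum>n. (V x n)\<^sup>\<star> * y n)"
    using y by (auto simp: is_adjoint_def)
qed

lemma adjointable_ell2_bounded:
  assumes V: "V \<in> adjointable X ell2"
  obtains K where "K > 0" "\<And>x. x \<in> hcarrier X \<Longrightarrow> (\<Sum>n. (V x n)\<^sup>\<star> * V x n) \<preceq> K *\<^sub>R hip X x x"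
proof -
  have s: "summable (\<lambda>n. (V x n)\<^sup>\<star> * V x n)" if "x \<in> hcarrier X" for x
    using V that by (auto simp: adjointable_def)
  have "symmetric (\<lambda>x. adj X ell2 V (V x))"
    unfolding symmetric_def
  proof (intro conjI ballI)
    fix x y assume x: "x \<in> hcarrier X" and y: "y \<in> hcarrier X"
    have "hip X (adj X ell2 V (V x)) y = (hip X y (adj X ell2 V (V x)))\<^sup>\<star>"
      by (rule ip_sym) (simp_all add: y adj_ell2(1)[OF V s[OF x]])
    also have "\<dots> = (\<Sum>n. (V x n)\<^sup>\<star> * V y n)"
      by (simp add: adj_ell2(2)[OF V s[OF x] y] ell2_ip_sym[OF s[OF y] s[OF x]])
    also have "\<dots> = hip X x (adj X ell2 V (V y))" by (simp add: adj_ell2(2)[OF V s[OF y] x])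
    finally show "hip X (adj X ell2 V (V x)) y = hip X x (adj X ell2 V (V y))" .
  qed (use adj_ell2(1)[OF V s] in auto)
  then obtain K where "K > 0"
    "\<And>x. x \<in> hcarrier X \<Longrightarrow> hip X x (adj X ell2 V (V x)) \<preceq> K *\<^sub>R hip X x x"
    using symmetric_ip_bounded by blast
  then show ?thesis using that[of K] adj_ell2(2)[OF V s] by simp
qed

end

section \<open>Finite extensions\<close>

lemma summable_prepend:
  fixes f :: "nat \<Rightarrow> 'a::real_normed_vector"
  assumes "summable (\<lambda>n. f (n + N))"
  shows "summable f" "suminf f = (\<Sum>n. f (n + N)) + (\<Sum>i<N. f i)"
proof -
  show "summable f" using assms by (simp add: summable_iff_shift)
  then show "suminf f = (\<Sum>n. f (n + N)) + (\<Sum>i<N. f i)"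
    by (rule suminf_split_initial_segment)
qed

context hilbert_module
begin

lemma finite_extension_of_perturbation:
  assumes v: "\<And>n. v n \<in> hcarrier (mult_module X)"
    and bessel: "bessel_ineq X (\<lambda>x n. (mip X (v n) x)\<^sup>\<star> * mip X (v n) x)"
    and V: "V \<in> adjointable X ell2"
    and w: "\<And>i. w i \<in> hcarrier (mult_module X)" and z: "\<And>i. z i \<in> hcarrier (mult_module X)"
    and rep: "\<And>x. x \<in> hcarrier X \<Longrightarrow>
      x - adj X ell2 V (\<lambda>n. mip X (v n) x) = (\<Sum>i<N. w i (mip X (z i) x))"
  shows "is_finite_extension X v (map z [0..<N])"
proof -
  define u where "u = prepend (map z [0..<N]) v"
  have u: "u i = z i" if "i < N" for i using that by (simp add: u_def prepend_def)
  have u_shift: "u (n + N) = v n" for n by (simp add: u_def prepend_def)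
  have uM: "u n \<in> hcarrier (mult_module X)" for n using v z by (simp add: u_def prepend_def)
  define q where "q x n = mip X (u n) x" for x n
  define p where "p x n = (if n < N then mip X (w n) x else V x (n - N))" for x n
  obtain B where B: "B > 0" "\<And>x. x \<in> hcarrier X \<Longrightarrow> summable (\<lambda>n. (mip X (v n) x)\<^sup>\<star> * mip X (v n) x)"
    "\<And>x. x \<in> hcarrier X \<Longrightarrow> (\<Sum>n. (mip X (v n) x)\<^sup>\<star> * mip X (v n) x) \<preceq> B *\<^sub>R hip X x x"
    using bessel by (auto simp: bessel_ineq_def)
  obtain C where C: "C > 0" "\<And>x. x \<in> hcarrier X \<Longrightarrow> (\<Sum>n. (V x n)\<^sup>\<star> * V x n) \<preceq> C *\<^sub>R hip X x x"
    using adjointable_ell2_bounded[OF V] by blast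
  have sV: "summable (\<lambda>n. (V x n)\<^sup>\<star> * V x n)" if "x \<in> hcarrier X" for x
    using V that by (auto simp: adjointable_def)
  have mip_sum: "\<exists>K>0. \<forall>x\<in>hcarrier X. (\<Sum>i<n. (mip X (t i) x)\<^sup>\<star> * mip X (t i) x) \<preceq> K *\<^sub>R hip X x x"
    if t: "\<And>i. t i \<in> hcarrier (mult_module X)" for t and n :: nat
  proof (induction n)
    case 0
    \<comment> \<open>The value 1 rather than 0 for the empty sum keeps all constants strictly
      positive.\<close>
    show ?case by (intro exI[of _ 1]) (simp add: ip_pos)
  next
    case (Suc n)
    then obtain K where K: "K > 0"
      "\<And>x. x \<in> hcarrier X \<Longrightarrow> (\<Sum>i<n. (mip X (t i) x)\<^sup>\<star> * mip X (t i) x) \<preceq> K *\<^sub>R hip X x x" by blast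
    obtain L where L: "L > 0" "\<And>x. x \<in> hcarrier X \<Longrightarrow> (mip X (t n) x)\<^sup>\<star> * mip X (t n) x \<preceq> L *\<^sub>R hip X x x"
      using mip_square_bounded[OF t] by blast
    have "(\<Sum>i<Suc n. (mip X (t i) x)\<^sup>\<star> * mip X (t i) x) \<preceq> (K + L) *\<^sub>R hip X x x" if "x \<in> hcarrier X" for x
      using cstar_le_add_mono[OF K(2)[OF that] L(2)[OF that]] by (simp add: scaleR_left_distrib)
    then show ?case using K(1) L(1) by (intro exI[of _ "K + L"]) simp
  qed
  obtain Kz where Kz: "Kz > 0"
    "\<And>x. x \<in> hcarrier X \<Longrightarrow> (\<Sum>i<N. (mip X (z i) x)\<^sup>\<star> * mip X (z i) x) \<preceq> Kz *\<^sub>R hip X x x"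
    using mip_sum[where t = z and n = N, OF z] by blast
  obtain Kw where Kw: "Kw > 0"
    "\<And>x. x \<in> hcarrier X \<Longrightarrow> (\<Sum>i<N. (mip X (w i) x)\<^sup>\<star> * mip X (w i) x) \<preceq> Kw *\<^sub>R hip X x x"
    using mip_sum[where t = w and n = N, OF w] by blast
  have sq: "summable (\<lambda>n. (q x n)\<^sup>\<star> * q x n)" "(\<Sum>n. (q x n)\<^sup>\<star> * q x n) \<preceq> (B + Kz) *\<^sub>R hip X x x"
    if x: "x \<in> hcarrier X" for x
  proof -
    have tail: "(\<lambda>n. (q x (n + N))\<^sup>\<star> * q x (n + N)) = (\<lambda>n. (mip X (v n) x)\<^sup>\<star> * mip X (v n) x)"
      by (simp add: q_def u_shift)
    have head: "(\<Sum>i<N. (q x i)\<^sup>\<star> * q x i) = (\<Sum>i<N. (mip X (z i) x)\<^sup>\<star> * mip X (z i) x)"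
      by (rule sum.cong) (simp_all add: q_def u)
    have s: "summable (\<lambda>n. (q x (n + N))\<^sup>\<star> * q x (n + N))" unfolding tail by (rule B(2)[OF x])
    show "summable (\<lambda>n. (q x n)\<^sup>\<star> * q x n)" by (rule summable_prepend(1)[OF s])
    show "(\<Sum>n. (q x n)\<^sup>\<star> * q x n) \<preceq> (B + Kz) *\<^sub>R hip X x x"
      unfolding summable_prepend(2)[OF s] tail head scaleR_left_distrib
      by (rule cstar_le_add_mono[OF B(3)[OF x] Kz(2)[OF x]])
  qed
  have sp: "summable (\<lambda>n. (p x n)\<^sup>\<star> * p x n)" "(\<Sum>n. (p x n)\<^sup>\<star> * p x n) \<preceq> (C + Kw) *\<^sub>R hip X x x"
    if x: "x \<in> hcarrier X" for x
  proof -
    have tail: "(\<lambda>n. (p x (n + N))\<^sup>\<star> * p x (n + N)) = (\<lambda>n. (V x n)\<^sup>\<star> * V x n)"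
      by (simp add: p_def)
    have head: "(\<Sum>i<N. (p x i)\<^sup>\<star> * p x i) = (\<Sum>i<N. (mip X (w i) x)\<^sup>\<star> * mip X (w i) x)"
      by (rule sum.cong) (simp_all add: p_def)
    have s: "summable (\<lambda>n. (p x (n + N))\<^sup>\<star> * p x (n + N))" unfolding tail by (rule sV[OF x])
    show "summable (\<lambda>n. (p x n)\<^sup>\<star> * p x n)" by (rule summable_prepend(1)[OF s])
    show "(\<Sum>n. (p x n)\<^sup>\<star> * p x n) \<preceq> (C + Kw) *\<^sub>R hip X x x"
      unfolding summable_prepend(2)[OF s] tail head scaleR_left_distrib
      by (rule cstar_le_add_mono[OF C(2)[OF x] Kw(2)[OF x]])
  qed
  have ip_eq: "hip X x x = (\<Sum>n. (p x n)\<^sup>\<star> * q x n)" if x: "x \<in> hcarrier X" for x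
  proof -
    have tail: "(\<lambda>n. (p x (n + N))\<^sup>\<star> * q x (n + N)) = (\<lambda>n. (V x n)\<^sup>\<star> * mip X (v n) x)"
      by (simp add: p_def q_def u_shift)
    have head: "(\<Sum>i<N. (p x i)\<^sup>\<star> * q x i) = (\<Sum>i<N. (mip X (w i) x)\<^sup>\<star> * mip X (z i) x)"
      by (rule sum.cong) (simp_all add: p_def q_def u)
    have s: "summable (\<lambda>n. (p x (n + N))\<^sup>\<star> * q x (n + N))"
      unfolding tail by (rule summable_ell2_ip[OF sV[OF x] B(2)[OF x]])
    let ?y = "adj X ell2 V (\<lambda>n. mip X (v n) x)"
    have "x = ?y + (\<Sum>i<N. w i (mip X (z i) x))" using rep[OF x] by (simp add: algebra_simps)
    then have "hip X x x = hip X x (?y + (\<Sum>i<N. w i (mip X (z i) x)))" by simp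
    also have "\<dots> = (\<Sum>n. (V x n)\<^sup>\<star> * mip X (v n) x) + (\<Sum>i<N. (mip X (w i) x)\<^sup>\<star> * mip X (z i) x)"
      using x w by (simp add: ip_add_right adj_ell2[OF V B(2)[OF x]] carrier_sum ip_sum_right ip_mult_module)
    also have "\<dots> = (\<Sum>n. (p x n)\<^sup>\<star> * q x n)"
      unfolding summable_prepend(2)[OF s] tail head ..
    finally show ?thesis .
  qed
  \<comment> \<open>With weight \<open>1/D\<close> in the arithmetic-geometric mean inequality the
    \<open>p\<close> part contributes at most one copy of <x, x>, which is absorbed by the two
    copies on the left.\<close>
  define D where "D = C + Kw"
  have D: "D > 0" using C(1) Kw(1) by (simp add: D_def)
  have lower: "(1/D) *\<^sub>R hip X x x \<preceq> (\<Sum>n. (q x n)\<^sup>\<star> * q x n)" if x: "x \<in> hcarrier X" for x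
  proof -
    let ?Q = "\<Sum>n. (q x n)\<^sup>\<star> * q x n"
    have "hip X x x + hip X x x \<preceq> (1/D) *\<^sub>R (\<Sum>n. (p x n)\<^sup>\<star> * p x n) + D *\<^sub>R ?Q"
      using ell2_am_gm[OF sp(1)[OF x] sq(1)[OF x], of "1/D"] D
        ell2_ip_sym[OF sp(1)[OF x] sq(1)[OF x]] ip_sym[OF x x]
      by (simp flip: ip_eq[OF x])
    also have "\<dots> \<preceq> (1/D) *\<^sub>R (D *\<^sub>R hip X x x) + D *\<^sub>R ?Q"
      by (intro cstar_le_add_mono cstar_le_scaleR_mono cstar_le_refl sp(2)[OF x, folded D_def])
        (use D in simp)
    finally have "hip X x x \<preceq> D *\<^sub>R ?Q"
      using D by (simp add: cstar_le_def)
    then have "(1/D) *\<^sub>R hip X x x \<preceq> (1/D) *\<^sub>R (D *\<^sub>R ?Q)" by (rule cstar_le_scaleR_mono) (use D in simp)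
    then show ?thesis using D by simp
  qed
  have "frame_ineq X (\<lambda>x n. (mip X (u n) x)\<^sup>\<star> * mip X (u n) x)"
    unfolding frame_ineq_def
    using D B(1) Kz(1) sq lower
    by (intro exI[of _ "1/D"] conjI exI[of _ "B + Kz"] ballI) (simp_all add: q_def)
  then show ?thesis
    using uM z by (auto simp: is_finite_extension_def frame_or_outer_frame_iff u_def)
qed

lemma perturbation_of_finite_extension:
  assumes ext: "is_finite_extension X v fs"
  obtains V \<theta> where "V \<in> adjointable X ell2" "\<theta> \<in> finite_rank_ops (mult_module X)"
    "\<And>x. x \<in> hcarrier X \<Longrightarrow>
      mult_embed X (x - adj X ell2 V (\<lambda>n. mip X (v n) x)) = \<theta> (mult_embed X x)"
proof -
  define u where "u = prepend fs v"
  define N where "N = length fs"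
  have u_shift: "u (n + N) = v n" for n by (simp add: u_def N_def prepend_def)
  have u: "\<And>n. u n \<in> hcarrier (mult_module X)"
    and frame: "frame_ineq X (\<lambda>x n. (mip X (u n) x)\<^sup>\<star> * mip X (u n) x)"
    using ext by (simp_all add: is_finite_extension_def frame_or_outer_frame_iff u_def)
  obtain A where A: "A > 0"
    "\<And>x. x \<in> hcarrier X \<Longrightarrow> A *\<^sub>R hip X x x \<preceq> (\<Sum>n. (mip X (u n) x)\<^sup>\<star> * mip X (u n) x)"
    using frame by (auto simp: frame_ineq_def)
  have bessel: "bessel_ineq X (\<lambda>x n. (mip X (u n) x)\<^sup>\<star> * mip X (u n) x)"
    using frame by (auto simp: frame_ineq_def bessel_ineq_def)
  define T where "T x n = mip X (u n) x" for x n
  have sT: "summable (\<lambda>n. (T x n)\<^sup>\<star> * T x n)" if "x \<in> hcarrier X" for x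
    using bessel that by (auto simp: bessel_ineq_def T_def)
  have "\<forall>y. \<exists>z. summable (\<lambda>n. (y n)\<^sup>\<star> * y n) \<longrightarrow>
    z \<in> hcarrier X \<and> (\<forall>x\<in>hcarrier X. hip X x z = (\<Sum>n. (T x n)\<^sup>\<star> * y n))"
    using synthesis_exists[OF u bessel] unfolding T_def by blast
  from choice[OF this] obtain Ts where Ts: "\<forall>y. summable (\<lambda>n. (y n)\<^sup>\<star> * y n) \<longrightarrow>
    Ts y \<in> hcarrier X \<and> (\<forall>x\<in>hcarrier X. hip X x (Ts y) = (\<Sum>n. (T x n)\<^sup>\<star> * y n))" ..
  have TsC: "Ts y \<in> hcarrier X" and ipTs: "\<And>x. x \<in> hcarrier X \<Longrightarrow> hip X x (Ts y) = (\<Sum>n. (T x n)\<^sup>\<star> * y n)"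
    if "summable (\<lambda>n. (y n)\<^sup>\<star> * y n)" for y
    using Ts that by blast+
  define S where "S x = Ts (T x)" for x
  have "symmetric S"
    unfolding symmetric_def
  proof (intro conjI ballI)
    fix x y assume x: "x \<in> hcarrier X" and y: "y \<in> hcarrier X"
    have "hip X (S x) y = (hip X y (S x))\<^sup>\<star>"
      by (rule ip_sym) (simp_all add: y S_def TsC[OF sT[OF x]])
    then show "hip X (S x) y = hip X x (S y)"
      by (simp add: S_def ipTs[OF sT[OF x] y] ipTs[OF sT[OF y] x] ell2_ip_sym[OF sT[OF y] sT[OF x]])
  qed (auto simp: S_def TsC sT)
  moreover have "A *\<^sub>R hip X x x \<preceq> hip X x (S x)" if x: "x \<in> hcarrier X" for x
    using A(2)[OF x] by (simp add: S_def ipTs[OF sT[OF x] x] T_def)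
  ultimately obtain Q where Q: "symmetric Q" "\<And>x. x \<in> hcarrier X \<Longrightarrow> Q (S x) = x"
    using symmetric_inverse[OF _ A(1)] by blast
  \<comment> \<open>In <y, x> = <Q y, S x> the right side is the sum of
    \<open>(T (Q y) n)\<^sup>\<star> * T x n\<close>. The terms from \<open>N\<close> on involve the
    old vectors only, which identifies the coefficients of \<open>V y\<close>.\<close>
  define V where "V x n = T (Q x) (n + N)" for x n
  have sV: "summable (\<lambda>n. (V x n)\<^sup>\<star> * V x n)" if "x \<in> hcarrier X" for x
    using summable_ignore_initial_segment[OF sT[of "Q x"], of N] Q(1) that by (simp add: V_def)
  \<comment> \<open>Padding with \<open>N\<close> zeros is adjoint to dropping the first
    \<open>N\<close> terms, so \<open>Q (Ts (shift y))\<close> is the adjoint of \<open>V\<close> at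
    \<open>y\<close>.\<close>
  define shift where "shift y n = (if n < N then 0 else y (n - N))" for y :: "nat \<Rightarrow> 'a" and n
  have shift: "(\<lambda>n. (shift y (n + N))\<^sup>\<star> * shift y (n + N)) = (\<lambda>n. (y n)\<^sup>\<star> * y n)" for y
    by (simp add: shift_def)
  have s_shift: "summable (\<lambda>n. (shift y n)\<^sup>\<star> * shift y n)" if "summable (\<lambda>n. (y n)\<^sup>\<star> * y n)" for y
    by (rule summable_prepend(1)[where N = N]) (simp only: shift that)
  have V: "V \<in> adjointable X ell2"
  proof -
    have "is_adjoint X ell2 V (\<lambda>y. Q (Ts (shift y)))"
      unfolding is_adjoint_def
    proof (intro conjI ballI)
      fix x and y :: "nat \<Rightarrow> 'a" assume x: "x \<in> hcarrier X" and "y \<in> hcarrier ell2"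
      then have y: "summable (\<lambda>n. (y n)\<^sup>\<star> * y n)" by simp
      have tail: "(\<lambda>n. (T (Q x) (n + N))\<^sup>\<star> * shift y (n + N)) = (\<lambda>n. (V x n)\<^sup>\<star> * y n)"
        by (simp add: V_def shift_def)
      have s: "summable (\<lambda>n. (T (Q x) (n + N))\<^sup>\<star> * shift y (n + N))"
        unfolding tail by (rule summable_ell2_ip[OF sV[OF x] y])
      have "hip X x (Q (Ts (shift y))) = hip X (Q x) (Ts (shift y))"
        using Q(1) x TsC[OF s_shift[OF y]] by (simp add: symmetric_ip)
      also have "\<dots> = (\<Sum>n. (T (Q x) n)\<^sup>\<star> * shift y n)"
        using Q(1) x by (intro ipTs s_shift y) simp
      also have "\<dots> = (\<Sum>n. (V x n)\<^sup>\<star> * y n)"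
        unfolding summable_prepend(2)[OF s] tail by (simp add: shift_def)
      finally show "hip ell2 (V x) y = hip X x (Q (Ts (shift y)))" by simp
    qed (use Q(1) TsC s_shift in auto)
    moreover have "V \<in> hcarrier X \<rightarrow> hcarrier ell2" using sV by auto
    ultimately show ?thesis unfolding adjointable_def by blast
  qed
  let ?w = "\<lambda>i a. Q (u i a)"
  have wM: "?w i \<in> hcarrier (mult_module X)" for i by (rule symmetric_comp_mult_module[OF Q(1) u])
  define \<theta> where "\<theta> = (\<Sum>i<N. theta (mult_module X) (?w i) (u i))"
  have "\<theta> \<in> finite_rank_ops (mult_module X)"
    unfolding \<theta>_def finite_rank_ops_def
    by (intro complex_vector.span_sum complex_vector.span_base) (use wM u in blast)
  moreover have "mult_embed X (x - adj X ell2 V (\<lambda>n. mip X (v n) x)) = \<theta> (mult_embed X x)"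
    if x: "x \<in> hcarrier X" for x
  proof -
    have tailT: "(\<lambda>n. T x (n + N)) = (\<lambda>n. mip X (v n) x)" by (simp add: T_def u_shift)
    have sv: "summable (\<lambda>n. (mip X (v n) x)\<^sup>\<star> * mip X (v n) x)"
      using summable_ignore_initial_segment[OF sT[OF x], of N] by (simp add: T_def u_shift)
    have C: "(\<Sum>i<N. ?w i (mip X (u i) x)) \<in> hcarrier X"
      by (rule carrier_sum) (rule mult_module_closed[OF wM])
    have eq: "x - adj X ell2 V (\<lambda>n. mip X (v n) x) = (\<Sum>i<N. ?w i (mip X (u i) x))"
    proof (rule ip_eqI)
      fix y assume y: "y \<in> hcarrier X"
      have Qy: "Q y \<in> hcarrier X" using Q(1) y by simp
      have tail: "(\<lambda>n. (T (Q y) (n + N))\<^sup>\<star> * T x (n + N)) = (\<lambda>n. (V y n)\<^sup>\<star> * mip X (v n) x)"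
        using tailT by (simp add: V_def fun_eq_iff)
      have s: "summable (\<lambda>n. (T (Q y) (n + N))\<^sup>\<star> * T x (n + N))"
        unfolding tail by (rule summable_ell2_ip[OF sV[OF y] sv])
      have "hip X y x = hip X y (Q (S x))" using Q(2)[OF x] by simp
      also have "\<dots> = hip X (Q y) (Ts (T x))"
        using symmetric_ip[OF Q(1) y TsC[OF sT[OF x]]] by (simp add: S_def)
      also have "\<dots> = (\<Sum>n. (T (Q y) n)\<^sup>\<star> * T x n)" by (rule ipTs[OF sT[OF x] Qy])
      also have "\<dots> = (\<Sum>n. (V y n)\<^sup>\<star> * mip X (v n) x) + (\<Sum>i<N. (T (Q y) i)\<^sup>\<star> * T x i)"
        unfolding summable_prepend(2)[OF s] tail ..
      also have "(\<Sum>n. (V y n)\<^sup>\<star> * mip X (v n) x) = hip X y (adj X ell2 V (\<lambda>n. mip X (v n) x))"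
        by (simp add: adj_ell2(2)[OF V sv y])
      also have "(\<Sum>i<N. (T (Q y) i)\<^sup>\<star> * T x i) = (\<Sum>i<N. hip X y (?w i (mip X (u i) x)))"
        by (rule sum.cong) (simp_all add: T_def symmetric_ip[OF Q(1) y] u ip_mult_module[OF u Qy])
      also have "\<dots> = hip X y (\<Sum>i<N. ?w i (mip X (u i) x))"
        by (rule ip_sum_right[symmetric, OF y]) (rule mult_module_closed[OF wM])
      finally show "hip X y (x - adj X ell2 V (\<lambda>n. mip X (v n) x)) = hip X y (\<Sum>i<N. ?w i (mip X (u i) x))"
        by (simp add: ip_diff_right[OF y x adj_ell2(1)[OF V sv]])
    qed (simp_all add: C x adj_ell2(1)[OF V sv])
    have "\<theta> (mult_embed X x) a = mult_embed X (\<Sum>i<N. ?w i (mip X (u i) x)) a" for a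
    proof -
      have sum_apply: "(\<Sum>i<n. F i) t a = (\<Sum>i<n. F i t a)"
        for F :: "nat \<Rightarrow> ('a \<Rightarrow> 'x) \<Rightarrow> 'a \<Rightarrow> 'x" and t and n :: nat
        by (induction n) simp_all
      have "\<theta> (mult_embed X x) a = (\<Sum>i<N. ?w i (mip X (u i) x * a))"
        unfolding \<theta>_def sum_apply by (simp add: theta_embed u x)
      also have "\<dots> = (\<Sum>i<N. hact X (?w i (mip X (u i) x)) a)"
        by (rule sum.cong) (simp_all only: mult_module_mult[OF wM])
      also have "\<dots> = hact X (\<Sum>i<N. ?w i (mip X (u i) x)) a"
        by (rule act_sum[symmetric]) (rule mult_module_closed[OF wM])
      finally show ?thesis by (simp add: mult_embed_def)
    qed
    then show ?thesis by (simp add: eq fun_eq_iff)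
  qed
  ultimately show ?thesis using that V by blast
qed

end

theorem theorem6p1:
  fixes X :: "('x::complex_vector, 'a::cstar_algebra) hmod"
    and v :: "nat \<Rightarrow> 'a \<Rightarrow> 'x"
    and U :: "'x \<Rightarrow> nat \<Rightarrow> 'a"
  assumes "hilbert_module X"
    and "bessel_or_outer_bessel X v"
    and "U = analysis_op X v"
  shows "(\<exists>fs. is_finite_extension X v fs) \<longleftrightarrow>
    (\<exists>V\<in>adjointable X ell2. \<exists>\<theta>\<in>finite_rank_ops (mult_module X).
       \<forall>x\<in>hcarrier X. mult_embed X (x - adj X ell2 V (U x)) = \<theta> (mult_embed X x))"
proof -
  interpret hilbert_module X by fact
  have U: "U x = (\<lambda>n. mip X (v n) x)" for x by (simp add: assms(3) analysis_op_def)
  note v = bessel_or_outer_besselD[OF assms(2)]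
  show ?thesis
  proof
    assume "\<exists>fs. is_finite_extension X v fs"
    then obtain fs where "is_finite_extension X v fs" by blast
    from perturbation_of_finite_extension[OF this]
    show "\<exists>V\<in>adjointable X ell2. \<exists>\<theta>\<in>finite_rank_ops (mult_module X).
       \<forall>x\<in>hcarrier X. mult_embed X (x - adj X ell2 V (U x)) = \<theta> (mult_embed X x)"
      unfolding U by metis
  next
    assume "\<exists>V\<in>adjointable X ell2. \<exists>\<theta>\<in>finite_rank_ops (mult_module X).
       \<forall>x\<in>hcarrier X. mult_embed X (x - adj X ell2 V (U x)) = \<theta> (mult_embed X x)"
    then obtain V \<theta> where V: "V \<in> adjointable X ell2" and \<theta>: "\<theta> \<in> finite_rank_ops (mult_module X)"
      and eq: "\<And>x. x \<in> hcarrier X \<Longrightarrow> mult_embed X (x - adj X ell2 V (U x)) = \<theta> (mult_embed X x)"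
      by blast
    obtain N :: nat and w z where wz: "\<And>i. w i \<in> hcarrier (mult_module X)" "\<And>i. z i \<in> hcarrier (mult_module X)"
      "\<And>x a. x \<in> hcarrier X \<Longrightarrow> \<theta> (mult_embed X x) a = (\<Sum>i<N. w i (mip X (z i) x * a))"
      by (rule finite_rank_ops_embed[OF \<theta>], rule that)
    \<comment> \<open>The assumed identity lives in M(X), with an extra factor \<open>a\<close>
      inside each \<open>w i\<close>. Module linearity of \<open>w i\<close> moves \<open>a\<close>
      outside, and injectivity of the embedding then yields the identity in X.\<close>
    have "x - adj X ell2 V (\<lambda>n. mip X (v n) x) = (\<Sum>i<N. w i (mip X (z i) x))" if x: "x \<in> hcarrier X" for x
    proof (rule mult_embed_inject)
      have "summable (\<lambda>n. (mip X (v n) x)\<^sup>\<star> * mip X (v n) x)"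
        using v(2) x by (auto simp: bessel_ineq_def)
      then show "x - adj X ell2 V (\<lambda>n. mip X (v n) x) \<in> hcarrier X"
        using x adj_ell2(1)[OF V] by simp
      show "(\<Sum>i<N. w i (mip X (z i) x)) \<in> hcarrier X" by (rule carrier_sum) (simp add: wz(1))
      show "mult_embed X (x - adj X ell2 V (\<lambda>n. mip X (v n) x)) = mult_embed X (\<Sum>i<N. w i (mip X (z i) x))"
      proof
        fix a
        have "mult_embed X (x - adj X ell2 V (\<lambda>n. mip X (v n) x)) a = (\<Sum>i<N. w i (mip X (z i) x * a))"
          using eq[OF x] wz(3)[OF x] by (simp add: U)
        also have "\<dots> = (\<Sum>i<N. hact X (w i (mip X (z i) x)) a)"
          by (rule sum.cong) (simp_all only: mult_module_mult[OF wz(1)])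
        also have "\<dots> = hact X (\<Sum>i<N. w i (mip X (z i) x)) a"
          by (rule act_sum[symmetric]) (rule mult_module_closed[OF wz(1)])
        finally show "mult_embed X (x - adj X ell2 V (\<lambda>n. mip X (v n) x)) a
            = mult_embed X (\<Sum>i<N. w i (mip X (z i) x)) a"
          by (simp add: mult_embed_def)
      qed
    qed
    from finite_extension_of_perturbation[OF v V wz(1,2) this]
    show "\<exists>fs. is_finite_extension X v fs" by blast
  qed
qed

end
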